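(* Let $\Gamma$ be a finite, simple, connected $3$-valent graph and let $G\le \mathrm{Aut}(\Gamma)$ be a group acting transitively on the edge-set $\mathrm{E}(\Gamma)$. Then $G$ contains a semiregular element, that is, a non-identity element $g$ such that the cyclic group $\langle g\rangle$ acts semiregularly on the vertex-set $\mathrm{V}(\Gamma)$ (every vertex has trivial stabiliser in $\langle g\rangle$; equivalently, all cycles of $g$ on $\mathrm{V}(\Gamma)$ have the same length).
   Context: All graphs are finite and simple. A graph $\Gamma$ is $G$-edge-transitive if $G\le\mathrm{Aut}(\Gamma)$ acts transitively on $\mathrm{E}(\Gamma)$. A group acting on a set is semiregular if all point stabilisers are trivial. *)

theory Defs
  imports "HOL-Algebra.Algebra"
begin

definition simple_graph :: "'a set \<Rightarrow> ('a \<Rightarrow> 'a \<Rightarrow> bool) \<Rightarrow> bool" where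
  "simple_graph V E \<longleftrightarrow> finite V \<and> (\<forall>x y. E x y \<longrightarrow> x \<in> V \<and> y \<in> V) \<and>
     (\<forall>x y. E x y \<longrightarrow> E y x) \<and> (\<forall>x. \<not> E x x)"

definition connected_graph :: "'a set \<Rightarrow> ('a \<Rightarrow> 'a \<Rightarrow> bool) \<Rightarrow> bool" where
  "connected_graph V E \<longleftrightarrow> V \<noteq> {} \<and> (\<forall>u\<in>V. \<forall>v\<in>V. E\<^sup>*\<^sup>* u v)"

definition cubic :: "'a set \<Rightarrow> ('a \<Rightarrow> 'a \<Rightarrow> bool) \<Rightarrow> bool" where
  "cubic V E \<longleftrightarrow> (\<forall>v\<in>V. card {w. E v w} = 3)"

definition graph_aut :: "'a set \<Rightarrow> ('a \<Rightarrow> 'a \<Rightarrow> bool) \<Rightarrow> ('a \<Rightarrow> 'a) set" where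
  "graph_aut V E = {g \<in> Bij V. \<forall>x\<in>V. \<forall>y\<in>V. E x y \<longleftrightarrow> E (g x) (g y)}"

definition edge_transitive :: "('a \<Rightarrow> 'a \<Rightarrow> bool) \<Rightarrow> ('a \<Rightarrow> 'a) set \<Rightarrow> bool" where
  "edge_transitive E G \<longleftrightarrow>
     (\<forall>u v x y. E u v \<longrightarrow> E x y \<longrightarrow> (\<exists>g\<in>G. {g u, g v} = {x, y}))"

definition semiregular_element :: "'a set \<Rightarrow> ('a \<Rightarrow> 'a) \<Rightarrow> bool" where
  "semiregular_element V g \<longleftrightarrow>
     g \<noteq> \<one>\<^bsub>BijGroup V\<^esub> \<and>
     (\<forall>k::int. \<forall>v\<in>V. (g [^]\<^bsub>BijGroup V\<^esub> k) v = v \<longrightarrow> g [^]\<^bsub>BijGroup V\<^esub> k = \<one>\<^bsub>BijGroup V\<^esub>)"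

end

theory Submission
  imports Defs "Jordan_Normal_Form.Schur_Decomposition" "HOL-Number_Theory.Cong"
    "HOL-Analysis.Inner_Product"
begin

text \<open>
  An automorphism of prime order \<open>p > 3\<close> that fixes a vertex fixes its three neighbours and hence,
  by connectedness, everything; so one may assume \<open>|G| = 2\<^sup>a 3\<^sup>b\<close>. By Burnside's theorem \<open>G\<close> is then
  solvable and has a nontrivial normal elementary abelian \<open>p\<close>-subgroup \<open>Z\<close> with \<open>p = 2\<close> or \<open>p = 3\<close>.
  Vertex stabilisers in \<open>G\<close> are transitive on neighbours. If \<open>p = 2\<close>, an element of \<open>Z\<close> fixing a vertex
  fixes one of its three neighbours, hence all of them, and \<open>Z\<close> is semiregular. If \<open>p = 3\<close>, either \<open>Z\<close>
  contains a fixed-point-free element or the graph is the complete bipartite graph on 3 + 3 vertices,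
  where one obtains an element rotating both sides.

  Burnside's theorem for the primes 2 and \<open>p\<close> needs no representation theory. In a nonabelian simple
  group \<open>G\<close> of order \<open>2\<^sup>a p\<^sup>b\<close> some class \<open>C\<close> of involutions has odd size \<open>q = p\<^sup>c > 1\<close>. Let the class
  sum of \<open>C\<close> act on the functions on \<open>G\<close> with mean value 0, let \<open>l \<noteq> 0\<close> be an eigenvalue and \<open>n\<close> its
  multiplicity. For \<open>t \<in> C\<close> the involutions \<open>x \<mapsto> tx\<close> and \<open>x \<mapsto> txt\<close> have integral traces
  \<open>n l / q\<close> and \<open>n l\<^sup>2 / q\<^sup>2\<close> on the eigenspace. Hence \<open>l\<close> is a rational algebraic integer, and
  \<open>|l| < q\<close> by simplicity, which together force \<open>p\<close> to divide \<open>n l / q\<close>. But these numbers sum to \<open>-1\<close>,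
  since left multiplication by \<open>t\<close> has trace 0 on all functions and trace 1 on the constants.
\<close>

hide_const (open) Divisibility.prime Polynomial.order
hide_fact (open) Polynomial.order_def

section \<open>Traces of powers of kernels\<close>

definition mat_trace :: "'a :: comm_monoid_add mat \<Rightarrow> 'a" where
  "mat_trace A = (\<Sum>i<dim_row A. A $$ (i, i))"

lemma mat_trace_mult_commute:
  fixes A B :: "'a :: comm_semiring_0 mat"
  assumes "A \<in> carrier_mat n m" "B \<in> carrier_mat m n"
  shows "mat_trace (A * B) = mat_trace (B * A)"
proof -
  have "mat_trace (A * B) = (\<Sum>i<n. \<Sum>k<m. A $$ (i, k) * B $$ (k, i))"
    using assms by (auto simp: mat_trace_def scalar_prod_def atLeast0LessThan intro!: sum.cong)
  also have "\<dots> = (\<Sum>k<m. \<Sum>i<n. B $$ (k, i) * A $$ (i, k))"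
    by (subst sum.swap) (simp add: mult.commute)
  also have "\<dots> = mat_trace (B * A)"
    using assms by (auto simp: mat_trace_def scalar_prod_def atLeast0LessThan intro!: sum.cong)
  finally show ?thesis .
qed

lemma mat_trace_similar:
  fixes A B :: "'a :: comm_ring_1 mat"
  assumes A: "A \<in> carrier_mat n n" and "similar_mat A B"
  shows "mat_trace A = mat_trace B"
proof -
  obtain P Q where wit: "similar_mat_wit A B P Q"
    using assms(2) unfolding similar_mat_def by blast
  note PQ = similar_mat_witD2[OF A wit]
  have "mat_trace A = mat_trace (Q * (P * B))"
    using PQ by (subst PQ(3), intro mat_trace_mult_commute[of _ n n]) auto
  also have "Q * (P * B) = (Q * P) * B"
    using PQ by (intro assoc_mult_mat[symmetric, of _ n n _ n _ n]) auto
  also have "\<dots> = B"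
    using PQ by simp
  finally show ?thesis .
qed

lemma upper_triangular_mult:
  fixes A B :: "'a :: semiring_0 mat"
  assumes A: "A \<in> carrier_mat n n" "upper_triangular A"
    and B: "B \<in> carrier_mat n n" "upper_triangular B"
  shows "upper_triangular (A * B)"
    and "i < n \<Longrightarrow> (A * B) $$ (i, i) = A $$ (i, i) * B $$ (i, i)"
proof -
  have entry: "(A * B) $$ (i, j) = (\<Sum>k<n. A $$ (i, k) * B $$ (k, j))" if "i < n" "j < n" for i j
    using assms that by (auto simp: scalar_prod_def atLeast0LessThan)
  have vanish: "A $$ (i, k) * B $$ (k, j) = 0" if "i < n" "k < n" "k < i \<or> j < k" for i j k
    using that upper_triangularD[OF A(2), of k i] upper_triangularD[OF B(2), of j k] A(1) B(1)
    by auto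
  show "upper_triangular (A * B)"
  proof
    fix i j assume ij: "j < i" "i < dim_row (A * B)"
    then have "A $$ (i, k) * B $$ (k, j) = 0" if "k < n" for k
      using that A(1) by (intro vanish) auto
    then show "(A * B) $$ (i, j) = 0"
      using ij A(1) by (subst entry) (auto intro!: sum.neutral)
  qed
  show "(A * B) $$ (i, i) = A $$ (i, i) * B $$ (i, i)" if "i < n"
  proof -
    have "(A * B) $$ (i, i) = (\<Sum>k\<in>{i}. A $$ (i, k) * B $$ (k, i))"
      unfolding entry[OF that that]
      using that by (intro sum.mono_neutral_right ballI vanish) auto
    then show ?thesis by simp
  qed
qed

lemma upper_triangular_pow:
  fixes B :: "'a :: comm_semiring_1 mat"
  assumes B: "B \<in> carrier_mat n n" "upper_triangular B"
  shows "upper_triangular (B ^\<^sub>m k)" and "i < n \<Longrightarrow> (B ^\<^sub>m k) $$ (i, i) = (B $$ (i, i)) ^ k"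
proof -
  have "upper_triangular (B ^\<^sub>m k) \<and> (\<forall>i<n. (B ^\<^sub>m k) $$ (i, i) = (B $$ (i, i)) ^ k)"
  proof (induction k)
    case 0
    then show ?case using B by (auto simp: upper_triangular_def)
  next
    case (Suc k)
    then show ?case
      using upper_triangular_mult[of "B ^\<^sub>m k" n B] B by (auto simp: mult.commute)
  qed
  then show "upper_triangular (B ^\<^sub>m k)" and "i < n \<Longrightarrow> (B ^\<^sub>m k) $$ (i, i) = (B $$ (i, i)) ^ k"
    by auto
qed

lemma mat_trace_pow_eq_power_sum:
  fixes A :: "complex mat"
  assumes A: "A \<in> carrier_mat n n"
  obtains ev where "\<And>k. mat_trace (A ^\<^sub>m k) = (\<Sum>i<n. ev i ^ k)"
    and "\<And>i. i < n \<Longrightarrow> eigenvalue A (ev i)"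
proof -
  obtain as where as: "char_poly A = (\<Prod>a\<leftarrow>as. [:- a, 1:])"
    using char_poly_factorized[OF A] by blast
  obtain B where B: "B \<in> carrier_mat n n" "upper_triangular B" "similar_mat A B"
    using schur_decomposition_exists[OF A as] by blast
  have "mat_trace (A ^\<^sub>m k) = (\<Sum>i<n. (B $$ (i, i)) ^ k)" for k
  proof -
    have "similar_mat (A ^\<^sub>m k) (B ^\<^sub>m k)"
      using B(3) similar_mat_wit_pow unfolding similar_mat_def by blast
    then have "mat_trace (A ^\<^sub>m k) = mat_trace (B ^\<^sub>m k)"
      using A by (intro mat_trace_similar[of _ n]) auto
    also have "\<dots> = (\<Sum>i<n. (B $$ (i, i)) ^ k)"
      using upper_triangular_pow(2)[OF B(1,2), of _ k] B(1) by (auto simp: mat_trace_def)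
    finally show ?thesis .
  qed
  moreover have "eigenvalue A (B $$ (i, i))" if "i < n" for i
  proof -
    have "char_poly A = (\<Prod>a\<leftarrow>diag_mat B. [:- a, 1:])"
      using char_poly_similar[OF B(3)] char_poly_upper_triangular[OF B(1,2)] by simp
    moreover have "B $$ (i, i) \<in> set (diag_mat B)"
      using that B(1) by (auto simp: diag_mat_def)
    ultimately have "poly (char_poly A) (B $$ (i, i)) = 0"
      by (simp add: poly_prod_list prod_list_zero_iff)
    then show ?thesis using eigenvalue_root_char_poly[OF A] by simp
  qed
  ultimately show ?thesis by (rule that)
qed

definition kernel_trace :: "'x set \<Rightarrow> ('x \<Rightarrow> 'x \<Rightarrow> 'c :: comm_monoid_add) \<Rightarrow> 'c" where
  "kernel_trace D F = (\<Sum>x\<in>D. F x x)"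

primrec kernel_pow :: "'x set \<Rightarrow> ('x \<Rightarrow> 'x \<Rightarrow> 'c :: semiring_1) \<Rightarrow> nat \<Rightarrow> 'x \<Rightarrow> 'x \<Rightarrow> 'c" where
  "kernel_pow D F 0 = (\<lambda>x y. of_bool (x = y))"
| "kernel_pow D F (Suc j) = (\<lambda>x y. \<Sum>z\<in>D. kernel_pow D F j x z * F z y)"

lemma kernel_pow_one: "finite D \<Longrightarrow> x \<in> D \<Longrightarrow> kernel_pow D F (Suc 0) x y = F x y"
  by (simp add: of_bool_def if_distrib[of "\<lambda>c. c * _"] cong: if_cong)

declare kernel_pow.simps(2) [simp del]

definition kernel_eigenvalue :: "'x set \<Rightarrow> ('x \<Rightarrow> 'x \<Rightarrow> 'c :: semiring_0) \<Rightarrow> 'c \<Rightarrow> bool" where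
  "kernel_eigenvalue D F l \<longleftrightarrow>
     (\<exists>v. (\<exists>x\<in>D. v x \<noteq> 0) \<and> (\<forall>x\<in>D. (\<Sum>y\<in>D. F x y * v y) = l * v x))"

definition kernel_mat :: "(nat \<Rightarrow> 'x) \<Rightarrow> nat \<Rightarrow> ('x \<Rightarrow> 'x \<Rightarrow> 'c) \<Rightarrow> 'c mat" where
  "kernel_mat e n F = mat n n (\<lambda>(i, j). F (e i) (e j))"

lemma kernel_mat_carrier [simp]: "kernel_mat e n F \<in> carrier_mat n n"
  by (simp add: kernel_mat_def)

context
  fixes e :: "nat \<Rightarrow> 'x" and n :: nat and D :: "'x set"
  assumes enum: "bij_betw e {0..<n} D"
begin

lemma sum_enum: "(\<Sum>j=0..<n. g (e j)) = (\<Sum>x\<in>D. g x)"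
  by (rule sum.reindex_bij_betw[OF enum])

lemma enum_mem: "i < n \<Longrightarrow> e i \<in> D"
  using enum by (auto simp: bij_betw_def)

lemma mat_trace_kernel_mat: "mat_trace (kernel_mat e n F) = kernel_trace D F"
  using sum_enum[of "\<lambda>x. F x x"]
  by (simp add: mat_trace_def kernel_mat_def kernel_trace_def atLeast0LessThan)

lemma kernel_mat_pow:
  fixes F :: "'x \<Rightarrow> 'x \<Rightarrow> 'c :: semiring_1"
  shows "kernel_mat e n F ^\<^sub>m k = kernel_mat e n (kernel_pow D F k)"
proof (induction k)
  case 0
  have "inj_on e {0..<n}" using enum by (simp add: bij_betw_def)
  then show ?case
    by (intro eq_matI) (auto simp: kernel_mat_def inj_on_eq_iff)
next
  case (Suc k)
  have "kernel_mat e n F ^\<^sub>m Suc k = kernel_mat e n (kernel_pow D F k) * kernel_mat e n F"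
    by (simp add: Suc.IH)
  also have "\<dots> = kernel_mat e n (kernel_pow D F (Suc k))"
    by (rule eq_matI) (auto simp: kernel_mat_def kernel_pow.simps(2) scalar_prod_def simp flip: sum_enum)
  finally show ?case .
qed

lemma eigenvalue_kernel_mat:
  fixes F :: "'x \<Rightarrow> 'x \<Rightarrow> 'c :: field"
  shows "eigenvalue (kernel_mat e n F) l \<longleftrightarrow> kernel_eigenvalue D F l"
proof
  assume "eigenvalue (kernel_mat e n F) l"
  then obtain v where v: "v \<in> carrier_vec n" "v \<noteq> 0\<^sub>v n" "kernel_mat e n F *\<^sub>v v = l \<cdot>\<^sub>v v"
    by (auto simp: eigenvalue_def eigenvector_def kernel_mat_def)
  define w where "w x = v $ the_inv_into {0..<n} e x" for x
  have w: "w (e i) = v $ i" if "i < n" for i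
    using enum that by (simp add: w_def bij_betw_def the_inv_into_f_f)
  have eigen: "(\<Sum>y\<in>D. F (e i) y * w y) = l * w (e i)" if "i < n" for i
  proof -
    have "(\<Sum>y\<in>D. F (e i) y * w y) = (kernel_mat e n F *\<^sub>v v) $ i"
      using that v(1) by (simp add: kernel_mat_def scalar_prod_def w flip: sum_enum)
    then show ?thesis using that v(1,3) w by simp
  qed
  obtain i where "i < n" "v $ i \<noteq> 0"
    using v(1,2) by (auto simp: vec_eq_iff)
  then have "\<exists>x\<in>D. w x \<noteq> 0" using w enum_mem by metis
  moreover have "\<forall>x\<in>D. (\<Sum>y\<in>D. F x y * w y) = l * w x"
    using eigen enum by (auto simp: bij_betw_def)
  ultimately show "kernel_eigenvalue D F l"
    unfolding kernel_eigenvalue_def by blast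
next
  assume "kernel_eigenvalue D F l"
  then obtain w x where w: "x \<in> D" "w x \<noteq> 0" "\<And>x. x \<in> D \<Longrightarrow> (\<Sum>y\<in>D. F x y * w y) = l * w x"
    unfolding kernel_eigenvalue_def by blast
  define v where "v = vec n (\<lambda>i. w (e i))"
  obtain i where "i < n" "x = e i" using w(1) enum by (auto simp: bij_betw_def)
  then have "v \<noteq> 0\<^sub>v n" using w(2) by (auto simp: v_def vec_eq_iff)
  moreover have "kernel_mat e n F *\<^sub>v v = l \<cdot>\<^sub>v v"
  proof (rule eq_vecI)
    fix i assume "i < dim_vec (l \<cdot>\<^sub>v v)"
    then have "i < n" by (simp add: v_def)
    then show "(kernel_mat e n F *\<^sub>v v) $ i = (l \<cdot>\<^sub>v v) $ i"
      using w(3)[OF enum_mem] by (simp add: kernel_mat_def v_def scalar_prod_def flip: sum_enum)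
  qed (simp add: kernel_mat_def v_def)
  ultimately show "eigenvalue (kernel_mat e n F) l"
    unfolding eigenvalue_def eigenvector_def
    by (intro exI[of _ v]) (auto simp: kernel_mat_def v_def)
qed

end

lemma integral_kernel_eigenvalue_algebraic_int:
  fixes F :: "'x \<Rightarrow> 'x \<Rightarrow> 'c :: field_char_0"
  assumes D: "finite D" and F: "\<And>x y. F x y \<in> \<int>" and l: "kernel_eigenvalue D F l"
  shows "algebraic_int l"
proof -
  obtain e where e: "bij_betw e {0..<card D} D"
    using ex_bij_betw_nat_finite[OF D] by blast
  have "\<forall>x y. \<exists>i. F x y = of_int i" by (meson F Ints_cases)
  then obtain f where f: "\<And>x y. F x y = of_int (f x y)" by metis
  let ?A = "kernel_mat e (card D) F" and ?B = "kernel_mat e (card D) f"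
  have "?A = map_mat of_int ?B"
    by (rule eq_matI) (auto simp: kernel_mat_def f)
  then have "char_poly ?A = map_poly of_int (char_poly ?B)"
    using of_int_hom.char_poly_hom[OF kernel_mat_carrier] by metis
  moreover have "poly (char_poly ?A) l = 0"
    using l eigenvalue_kernel_mat[OF e] eigenvalue_root_char_poly[OF kernel_mat_carrier] by blast
  ultimately show ?thesis
    using degree_monic_char_poly[OF kernel_mat_carrier, of e "card D" f]
    by (auto simp: algebraic_int_altdef_ipoly)
qed

definition kernel_spectrum :: "'x set \<Rightarrow> ('x \<Rightarrow> 'x \<Rightarrow> complex) \<Rightarrow> (complex \<Rightarrow> nat) \<Rightarrow> bool" where
  "kernel_spectrum D F m \<longleftrightarrow> finite {l. m l \<noteq> 0} \<and> (\<forall>l. m l \<noteq> 0 \<longrightarrow> kernel_eigenvalue D F l) \<and>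
     (\<forall>j. kernel_trace D (kernel_pow D F j) = (\<Sum>l | m l \<noteq> 0. of_nat (m l) * l ^ j))"

lemma ex_kernel_spectrum:
  assumes D: "finite D"
  shows "\<exists>m. kernel_spectrum D F m"
proof -
  obtain e where e: "bij_betw e {0..<card D} D"
    using ex_bij_betw_nat_finite[OF D] by blast
  obtain ev where ev: "\<And>k. mat_trace (kernel_mat e (card D) F ^\<^sub>m k) = (\<Sum>i<card D. ev i ^ k)"
      "\<And>i. i < card D \<Longrightarrow> eigenvalue (kernel_mat e (card D) F) (ev i)"
    using mat_trace_pow_eq_power_sum[OF kernel_mat_carrier] by blast
  define m where "m l = card {i. i < card D \<and> ev i = l}" for l
  have supp: "{l. m l \<noteq> 0} = ev ` {..<card D}"
    by (auto simp: m_def card_eq_0_iff)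
  have "kernel_trace D (kernel_pow D F j) = (\<Sum>l | m l \<noteq> 0. of_nat (m l) * l ^ j)" for j
  proof -
    have "kernel_trace D (kernel_pow D F j) = (\<Sum>i<card D. ev i ^ j)"
      using ev(1) by (simp add: kernel_mat_pow[OF e] mat_trace_kernel_mat[OF e])
    also have "\<dots> = (\<Sum>l\<in>ev ` {..<card D}. \<Sum>i | i \<in> {..<card D} \<and> ev i = l. ev i ^ j)"
      by (rule sum.image_gen) simp
    also have "\<dots> = (\<Sum>l | m l \<noteq> 0. of_nat (m l) * l ^ j)"
      unfolding supp by (intro sum.cong) (auto simp: m_def)
    finally show ?thesis .
  qed
  moreover have "kernel_eigenvalue D F l" if "m l \<noteq> 0" for l
  proof -
    have "l \<in> ev ` {..<card D}" using that unfolding supp[symmetric] by simp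
    then show ?thesis using ev(2) eigenvalue_kernel_mat[OF e] by auto
  qed
  ultimately show ?thesis
    unfolding kernel_spectrum_def using supp by (intro exI[of _ m]) simp
qed

lemma power_sums_zero_imp_coeff_zero:
  fixes f :: "'c :: idom \<Rightarrow> 'c"
  assumes S: "finite S" and zero: "\<And>j. (\<Sum>l\<in>S. f l * l ^ Suc j) = 0"
    and m: "m \<in> S" "m \<noteq> 0"
  shows "f m = 0"
proof -
  have vanish: "(\<Sum>l\<in>S. f l * l * poly p l) = 0" for p
  proof -
    have "(\<Sum>l\<in>S. f l * l * poly p l) = (\<Sum>l\<in>S. \<Sum>i\<le>degree p. coeff p i * (f l * l ^ Suc i))"
      by (simp add: poly_altdef sum_distrib_left mult_ac)
    also have "\<dots> = (\<Sum>i\<le>degree p. coeff p i * (\<Sum>l\<in>S. f l * l ^ Suc i))"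
      by (subst sum.swap) (simp only: sum_distrib_left)
    finally show ?thesis using zero by simp
  qed
  define p where "p = (\<Prod>a\<in>S - {m}. [:- a, 1:])"
  have "poly p l = 0" if "l \<in> S" "l \<noteq> m" for l
    using that S by (auto simp: p_def poly_prod)
  then have "(\<Sum>l\<in>S. f l * l * poly p l) = (\<Sum>l\<in>{m}. f l * l * poly p l)"
    using S m by (intro sum.mono_neutral_right) auto
  then have "f m * m * poly p m = 0" using vanish by simp
  moreover have "poly p m \<noteq> 0" using S by (auto simp: p_def poly_prod)
  ultimately show ?thesis using m by simp
qed

lemma kernel_pow_invariant:
  assumes s: "bij_betw s D D" and F: "\<And>x y. x \<in> D \<Longrightarrow> y \<in> D \<Longrightarrow> F (s x) (s y) = F x y"
    and "x \<in> D" "y \<in> D"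
  shows "kernel_pow D F j (s x) (s y) = kernel_pow D F j x y"
  using \<open>y \<in> D\<close>
proof (induction j arbitrary: y)
  case 0
  then show ?case
    using s \<open>x \<in> D\<close> by (auto simp: bij_betw_def dest: inj_onD)
next
  case (Suc j)
  have "kernel_pow D F (Suc j) (s x) (s y) = (\<Sum>z\<in>D. kernel_pow D F j (s x) (s z) * F (s z) (s y))"
    unfolding kernel_pow.simps by (rule sum.reindex_bij_betw[OF s, symmetric])
  also have "\<dots> = kernel_pow D F (Suc j) x y"
    unfolding kernel_pow.simps using Suc F by (auto intro!: sum.cong)
  finally show ?case .
qed

context
  fixes D :: "'x set" and s :: "'x \<Rightarrow> 'x" and F :: "'x \<Rightarrow> 'x \<Rightarrow> complex"
  assumes finite: "finite D"
    and closed: "\<And>x. x \<in> D \<Longrightarrow> s x \<in> D" and involution: "\<And>x. x \<in> D \<Longrightarrow> s (s x) = x"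
    and invariant: "\<And>x y. x \<in> D \<Longrightarrow> y \<in> D \<Longrightarrow> F (s x) (s y) = F x y"
begin

lemma kernel_pow_twist:
  assumes x: "x \<in> D" and y: "y \<in> D"
  shows "(\<Sum>z\<in>D. kernel_pow D F j x z * F (s z) y) = kernel_pow D F (Suc j) (s x) y"
proof -
  have s: "bij_betw s D D"
    by (rule bij_betwI[where g = s]) (use closed involution in auto)
  have "(\<Sum>z\<in>D. kernel_pow D F j x z * F (s z) y) = (\<Sum>z\<in>D. kernel_pow D F j x (s z) * F (s (s z)) y)"
    by (rule sum.reindex_bij_betw[OF s, symmetric])
  also have "\<dots> = (\<Sum>z\<in>D. kernel_pow D F j (s x) z * F z y)"
    using kernel_pow_invariant[where F = F and x = "s x", OF s invariant] x closed involution
    by (intro sum.cong) auto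
  finally show ?thesis by (simp add: kernel_pow.simps(2))
qed

text \<open>With \<open>P = (1 + s) / 2\<close>, a projection commuting with \<open>F\<close>, this says \<open>(F P)\<^sup>j = F\<^sup>j P\<close>.\<close>

lemma kernel_pow_symmetrization:
  assumes x: "x \<in> D" and "y \<in> D"
  shows "kernel_pow D (\<lambda>x y. (F x y + F (s x) y) / 2) (Suc j) x y =
    (kernel_pow D F (Suc j) x y + kernel_pow D F (Suc j) (s x) y) / 2"
  using \<open>y \<in> D\<close>
proof (induction j arbitrary: y)
  case 0
  show ?case
    by (simp add: kernel_pow_one[OF finite] x closed)
next
  case (Suc j)
  let ?P = "kernel_pow D F (Suc j)"
  have "kernel_pow D (\<lambda>x y. (F x y + F (s x) y) / 2) (Suc (Suc j)) x y =
      (\<Sum>z\<in>D. (?P x z + ?P (s x) z) / 2 * ((F z y + F (s z) y) / 2))"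
    by (subst kernel_pow.simps(2)) (intro sum.cong refl, simp only: Suc.IH)
  also have "\<dots> = ((\<Sum>z\<in>D. ?P x z * F z y) + (\<Sum>z\<in>D. ?P (s x) z * F z y)
      + ((\<Sum>z\<in>D. ?P x z * F (s z) y) + (\<Sum>z\<in>D. ?P (s x) z * F (s z) y))) / 4"
    unfolding sum.distrib[symmetric] sum_divide_distrib by (intro sum.cong) (auto simp: field_simps)
  also have "\<dots> = (kernel_pow D F (Suc (Suc j)) x y + kernel_pow D F (Suc (Suc j)) (s x) y) / 2"
    using kernel_pow_twist[OF x Suc.prems] kernel_pow_twist[OF closed[OF x] Suc.prems]
    by (simp add: involution[OF x] kernel_pow.simps(2)[of D F "Suc j"])
  finally show ?case .
qed

lemma kernel_trace_symmetrization:
  "2 * kernel_trace D (kernel_pow D (\<lambda>x y. (F x y + F (s x) y) / 2) (Suc j)) =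
    kernel_trace D (kernel_pow D F (Suc j)) + (\<Sum>x\<in>D. kernel_pow D F (Suc j) (s x) x)"
proof -
  have "2 * kernel_trace D (kernel_pow D (\<lambda>x y. (F x y + F (s x) y) / 2) (Suc j)) =
      (\<Sum>x\<in>D. kernel_pow D F (Suc j) x x + kernel_pow D F (Suc j) (s x) x)"
    unfolding kernel_trace_def sum_distrib_left
    by (intro sum.cong refl) (simp add: kernel_pow_symmetrization)
  then show ?thesis by (simp add: kernel_trace_def sum.distrib)
qed

text \<open>The symmetrized kernel has the eigenvalue \<open>l\<close> with an integral multiplicity, which is half of
  the sum of the multiplicity for \<open>F\<close> and of the trace of \<open>s\<close> on the \<open>l\<close>-eigenspace of \<open>F\<close>.\<close>

lemma twisted_multiplicity_in_Ints:
  assumes m: "kernel_spectrum D F m"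
    and twisted: "\<And>j. (\<Sum>x\<in>D. kernel_pow D F (Suc j) (s x) x) =
      c * kernel_trace D (kernel_pow D F (Suc j + k))"
    and l: "m l \<noteq> 0" "l \<noteq> 0"
  shows "c * of_nat (m l) * l ^ k \<in> \<int>"
proof -
  obtain m' where m': "kernel_spectrum D (\<lambda>x y. (F x y + F (s x) y) / 2) m'"
    using ex_kernel_spectrum[OF finite] by blast
  define S where "S = {l. m l \<noteq> 0} \<union> {l. m' l \<noteq> 0}"
  have S: "finite S" using m m' by (simp add: S_def kernel_spectrum_def)
  have trace: "kernel_trace D (kernel_pow D F j) = (\<Sum>l\<in>S. of_nat (m l) * l ^ j)"
      "kernel_trace D (kernel_pow D (\<lambda>x y. (F x y + F (s x) y) / 2) j) =
        (\<Sum>l\<in>S. of_nat (m' l) * l ^ j)" for j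
    using m m' S unfolding kernel_spectrum_def
    by (auto simp: S_def intro!: sum.mono_neutral_left)
  define f where "f l = 2 * of_nat (m' l) - of_nat (m l) - c * of_nat (m l) * l ^ k" for l
  have "(\<Sum>l\<in>S. f l * l ^ Suc j) = 0" for j
  proof -
    have "(\<Sum>l\<in>S. f l * l ^ Suc j) = 2 * (\<Sum>l\<in>S. of_nat (m' l) * l ^ Suc j)
        - (\<Sum>l\<in>S. of_nat (m l) * l ^ Suc j) - c * (\<Sum>l\<in>S. of_nat (m l) * l ^ (Suc j + k))"
      unfolding sum_distrib_left sum_subtractf[symmetric]
      by (intro sum.cong) (auto simp: f_def algebra_simps power_add)
    also have "\<dots> = 0"
      using kernel_trace_symmetrization[of j] twisted[of j] unfolding trace by simp
    finally show ?thesis .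
  qed
  then have "f l = 0"
    using power_sums_zero_imp_coeff_zero[OF S] l by (simp add: S_def)
  then have "c * of_nat (m l) * l ^ k = 2 * of_nat (m' l) - of_nat (m l)"
    by (simp add: f_def)
  also have "\<dots> \<in> \<int>" by (intro Ints_diff Ints_mult) auto
  finally show ?thesis .
qed

end

section \<open>Elements of prime order and centres of \<open>p\<close>-groups\<close>

context group
begin

lemma subgroup_pow_card:
  assumes H: "subgroup H G" and x: "x \<in> H"
  shows "x [^] card H = \<one>"
  using group.pow_order_eq_1[OF subgroup_imp_group[OF H], of x] x
  by (simp add: order_def flip: nat_pow_consistent)

lemma card_subgroup_dvd:
  assumes "subgroup H G" "subgroup K G" "H \<subseteq> K"
  shows "card H dvd card K"
proof -
  have "card (rcosets\<^bsub>G\<lparr>carrier := K\<rparr>\<^esub> H) * card H = card K"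
    using group.lagrange[OF subgroup_imp_group[OF assms(2)] subgroup_incl[OF assms]]
    by (simp add: order_def)
  then show ?thesis by (metis dvd_triv_right)
qed

lemma ord_eq_prime:
  assumes "x \<in> carrier G" "x \<noteq> \<one>" "x [^] p = \<one>" "prime p"
  shows "ord x = p"
  using assms prime_nat_iff pow_eq_id ord_eq_1 by metis

lemma subgroup_exists_ord_prime:
  assumes H: "subgroup H G" "finite H" and p: "prime p" "p dvd card H"
  obtains x where "x \<in> H" "ord x = p"
proof -
  obtain m where "order (G\<lparr>carrier := H\<rparr>) = p ^ 1 * m"
    using p(2) by (auto simp: order_def)
  then obtain P where P: "subgroup P (G\<lparr>carrier := H\<rparr>)" "card P = p ^ 1"
    using sylow_thm[OF p(1) subgroup_imp_group[OF H(1)], of 1 m] H(2) by auto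
  have sub: "subgroup P G" "P \<subseteq> H"
    using incl_subgroup[OF H(1) P(1)] subgroup.subset[OF P(1)] by auto
  have "P \<noteq> {\<one>}" using P(2) p(1) by auto
  then obtain x where x: "x \<in> P" "x \<noteq> \<one>" using subgroup.one_closed[OF sub(1)] by blast
  have "x [^] p = \<one>" using subgroup_pow_card[OF sub(1) x(1)] P(2) by simp
  then have "ord x = p"
    using ord_eq_prime x p(1) subgroup.mem_carrier[OF sub(1)] by blast
  then show ?thesis using that x sub(2) by blast
qed

end

lemma (in group_action) p_group_orbit:
  assumes p: "prime p" "order G = p ^ k" and x: "x \<in> E"
  shows "orbit G \<phi> x = {x} \<or> p dvd card (orbit G \<phi> x)"
proof -
  have "card (orbit G \<phi> x) dvd p ^ k"
    using orbit_stabilizer_theorem[OF x] p(2) by (metis dvd_triv_left)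
  then obtain i where i: "card (orbit G \<phi> x) = p ^ i"
    using divides_primepow_nat[OF p(1)] by blast
  show ?thesis
  proof (cases i)
    case 0
    then obtain y where "orbit G \<phi> x = {y}" using i by (auto simp: card_1_singleton_iff)
    then show ?thesis using orbit_refl[OF x] by simp
  qed (simp add: i)
qed

lemma (in group_action) card_eq_card_fixed_points_mod_prime:
  assumes p: "prime p" "order G = p ^ k" and E: "finite E"
  shows "[card E = card {x \<in> E. \<forall>g\<in>carrier G. \<phi> g x = x}] (mod p)"
proof -
  let ?Fix = "{x \<in> E. \<forall>g\<in>carrier G. \<phi> g x = x}"
  have fixed_iff: "x \<in> ?Fix \<longleftrightarrow> orbit G \<phi> x = {x}" if "x \<in> E" for x
    using that orbit_refl[OF that] by (auto simp: orbit_def)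
  have orbit_cong: "[(\<Sum>y\<in>orb. 1) = (\<Sum>y\<in>orb. of_bool (y \<in> ?Fix))] (mod p)"
    if orb: "orb \<in> orbits G E \<phi>" for orb
  proof -
    obtain x where x: "x \<in> E" "orb = orbit G \<phi> x" using orb by (auto simp: orbits_def)
    show ?thesis
    proof (cases "orb = {x}")
      case True
      then show ?thesis using fixed_iff[OF x(1)] x(2) by simp
    next
      case False
      have "y \<notin> ?Fix" if "y \<in> orb" for y
      proof
        assume y: "y \<in> ?Fix"
        then have "x \<in> orbit G \<phi> y" using orbit_sym[of x y] x that by auto
        then have "x \<in> ?Fix" using fixed_iff[of y] y by auto
        then show False using fixed_iff[OF x(1)] x(2) False by simp
      qed
      then have "(\<Sum>y\<in>orb. of_bool (y \<in> ?Fix)) = (0::nat)" by simp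
      moreover have "p dvd card orb" using p_group_orbit[OF p x(1)] False x(2) by simp
      ultimately show ?thesis by (simp add: cong_0_iff)
    qed
  qed
  have "card E = (\<Sum>orb\<in>orbits G E \<phi>. \<Sum>y\<in>orb. 1)"
    using disjoint_sum[OF E, of "\<lambda>_. 1::nat"] by simp
  moreover have "card ?Fix = (\<Sum>orb\<in>orbits G E \<phi>. \<Sum>y\<in>orb. of_bool (y \<in> ?Fix))"
    using disjoint_sum[OF E, of "\<lambda>y. of_bool (y \<in> ?Fix) :: nat"] E
    by (simp add: Int_def)
  ultimately show ?thesis by (simp only:) (rule cong_sum[OF orbit_cong])
qed

definition center :: "('a, 'b) monoid_scheme \<Rightarrow> 'a set" where
  "center G = {x \<in> carrier G. \<forall>y\<in>carrier G. x \<otimes>\<^bsub>G\<^esub> y = y \<otimes>\<^bsub>G\<^esub> x}"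

context group
begin

lemma inv_mult_cancel [simp]:
  assumes "x \<in> carrier G" "y \<in> carrier G"
  shows "inv x \<otimes> (x \<otimes> y) = y" "x \<otimes> (inv x \<otimes> y) = y"
  using assms by (simp_all flip: m_assoc)

lemma conj_eq_iff_commute:
  assumes "x \<in> carrier G" "y \<in> carrier G"
  shows "y \<otimes> x \<otimes> inv y = x \<longleftrightarrow> x \<otimes> y = y \<otimes> x"
  using assms by (metis inv_solve_right m_closed)

lemma center_conj_iff: "center G = {x \<in> carrier G. \<forall>y\<in>carrier G. y \<otimes> x \<otimes> inv y = x}"
  using conj_eq_iff_commute by (auto simp: center_def)

lemma center_normal: "center G \<lhd> G"
proof (rule normal_invI)
  show "subgroup (center G) G"
  proof (rule subgroupI)
    fix x y assume x: "x \<in> center G" and y: "y \<in> center G"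
    have "z \<otimes> (x \<otimes> y) \<otimes> inv z = (z \<otimes> x \<otimes> inv z) \<otimes> (z \<otimes> y \<otimes> inv z)" if "z \<in> carrier G" for z
      using x y that by (simp add: center_conj_iff m_assoc)
    then show "x \<otimes> y \<in> center G" using x y by (simp add: center_conj_iff)
  next
    fix x assume x: "x \<in> center G"
    have "z \<otimes> inv x \<otimes> inv z = inv (z \<otimes> x \<otimes> inv z)" if "z \<in> carrier G" for z
      using x that by (simp add: center_conj_iff inv_mult_group m_assoc)
    then show "inv x \<in> center G" using x by (simp add: center_conj_iff)
  qed (auto simp: center_def)
qed (auto simp: center_conj_iff)

lemma p_group_dvd_card_center:
  assumes p: "prime p" and order: "order G = p ^ k" "k > 0"
  shows "p dvd card (center G)"
proof -
  interpret conj: group_action G "carrier G" "\<lambda>g. \<lambda>h\<in>carrier G. g \<otimes> h \<otimes> inv g"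
    by (rule action_by_conjugation)
  have "finite (carrier G)"
    using order p by (intro card_ge_0_finite) (simp add: order_def prime_gt_0_nat)
  from conj.card_eq_card_fixed_points_mod_prime[OF p order(1) this]
  have "[card (carrier G) = card (center G)] (mod p)"
    by (simp add: center_conj_iff cong: conj_cong)
  moreover have "p dvd card (carrier G)" using order by (simp add: order_def)
  ultimately show ?thesis by (simp add: cong_dvd_iff)
qed

definition conj_class :: "'a \<Rightarrow> 'a set" where
  "conj_class t = (\<lambda>g. g \<otimes> t \<otimes> inv g) ` carrier G"

lemma conj_class_eq_orbit:
  "t \<in> carrier G \<Longrightarrow> conj_class t = orbit G (\<lambda>g. \<lambda>h\<in>carrier G. g \<otimes> h \<otimes> inv g) t"
  by (auto simp: orbit_def conj_class_def)

definition centralizer :: "'a \<Rightarrow> 'a set" where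
  "centralizer t = {g \<in> carrier G. g \<otimes> t \<otimes> inv g = t}"

lemma card_conj_class:
  assumes t: "t \<in> carrier G"
  shows "card (conj_class t) * card (centralizer t) = order G"
  using group_action.orbit_stabilizer_theorem[OF action_by_conjugation t] t
  by (simp add: conj_class_eq_orbit centralizer_def stabilizer_def)

lemma centralizer_subgroup:
  assumes "t \<in> carrier G"
  shows "subgroup (centralizer t) G"
  using group_action.stabilizer_subgroup[OF action_by_conjugation assms] assms
  by (simp add: centralizer_def stabilizer_def)

text \<open>An element of order \<open>p\<close> in the centre of a Sylow subgroup has a centralizer of index prime to \<open>p\<close>.\<close>

lemma exists_ord_prime_card_conj_class_coprime:
  assumes fin: "finite (carrier G)" and p: "prime p" "p dvd order G"
  obtains t where "t \<in> carrier G" "ord t = p" "\<not> p dvd card (conj_class t)"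
proof -
  define a where "a = multiplicity p (order G)"
  have order_pos: "order G > 0" using fin order_gt_0_iff_finite by blast
  then have a: "a > 0" using p by (simp add: a_def prime_multiplicity_gt_zero_iff)
  obtain m where m: "order G = p ^ a * m" "\<not> p dvd m"
    using multiplicity_decompose'[of "order G" p] order_pos p(1) unfolding a_def
    by (metis not_gr_zero not_prime_unit)
  obtain T where T: "subgroup T G" "card T = p ^ a"
    using sylow_thm[OF p(1) group_axioms m(1) fin] by blast
  let ?T = "G\<lparr>carrier := T\<rparr>"
  interpret T: group ?T using subgroup_imp_group[OF T(1)] .
  have Z: "subgroup (center ?T) G"
    using incl_subgroup[OF T(1) normal_imp_subgroup[OF T.center_normal]] .
  have "p dvd card (center ?T)"
    using T.p_group_dvd_card_center[OF p(1) _ a] T(2) by (simp add: order_def)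
  moreover have "finite (center ?T)"
    using Z fin finite_subset subgroup.subset by blast
  ultimately obtain t where t: "t \<in> center ?T" "ord t = p"
    using subgroup_exists_ord_prime[OF Z] p(1) by blast
  have tG: "t \<in> carrier G" using subgroup.mem_carrier[OF Z t(1)] .
  have "T \<subseteq> centralizer t"
    using t(1) subgroup.mem_carrier[OF T(1)] tG
    by (auto simp: centralizer_def center_def conj_eq_iff_commute)
  then have "p ^ a dvd card (centralizer t)"
    using card_subgroup_dvd[OF T(1) centralizer_subgroup[OF tG]] T(2) by simp
  then obtain i where "card (centralizer t) = p ^ a * i" by auto
  then have "card (conj_class t) * i = m"
    using card_conj_class[OF tG] m(1) p(1) by (auto simp: prime_gt_0_nat)
  then have "\<not> p dvd card (conj_class t)" using m(2) by auto
  then show ?thesis using that tG t(2) by blast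
qed

end

section \<open>Class sums of involutions\<close>

lemma eq_mean_if_norm_le:
  fixes z :: "'i \<Rightarrow> 'v :: real_inner"
  assumes I: "finite I" and le: "\<And>i. i \<in> I \<Longrightarrow> norm (z i) \<le> M"
    and ge: "real (card I) * M \<le> norm (\<Sum>i\<in>I. z i)" and i: "i \<in> I"
  shows "real (card I) *\<^sub>R z i = (\<Sum>i\<in>I. z i)"
proof -
  define n S where "n = real (card I)" and "S = (\<Sum>i\<in>I. z i)"
  have M: "M \<ge> 0" using le[OF i] norm_ge_zero order_trans by blast
  have "(norm (n *\<^sub>R z i - S))\<^sup>2 = n\<^sup>2 * (norm (z i))\<^sup>2 - 2 * n * inner (z i) S + (norm S)\<^sup>2" for i
    unfolding power2_norm_eq_inner
    by (simp add: inner_diff_left inner_diff_right inner_commute[of S "z i"] power2_eq_square[of n] algebra_simps)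
  then have "(\<Sum>i\<in>I. (norm (n *\<^sub>R z i - S))\<^sup>2) =
      n\<^sup>2 * (\<Sum>i\<in>I. (norm (z i))\<^sup>2) - 2 * n * inner (\<Sum>i\<in>I. z i) S + n * (norm S)\<^sup>2"
    by (simp add: sum.distrib sum_subtractf sum_distrib_left inner_sum_left n_def)
  also have "\<dots> = n * (n * (\<Sum>i\<in>I. (norm (z i))\<^sup>2) - (norm S)\<^sup>2)"
    by (simp add: S_def algebra_simps power2_eq_square flip: power2_norm_eq_inner)
  also have "\<dots> \<le> 0"
  proof -
    have "(\<Sum>i\<in>I. (norm (z i))\<^sup>2) \<le> n * M\<^sup>2"
      unfolding n_def by (rule sum_bounded_above) (simp add: le power_mono)
    then have "n * (\<Sum>i\<in>I. (norm (z i))\<^sup>2) \<le> n * (n * M\<^sup>2)"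
      by (rule mult_left_mono) (simp add: n_def)
    also have "\<dots> = (n * M)\<^sup>2" by (simp add: power2_eq_square)
    also have "\<dots> \<le> (norm S)\<^sup>2"
      using ge M by (intro power_mono) (auto simp: n_def S_def)
    finally show ?thesis by (simp add: n_def mult_nonneg_nonpos)
  qed
  finally have "(\<Sum>i\<in>I. (norm (n *\<^sub>R z i - S))\<^sup>2) \<le> 0" .
  then have "(\<Sum>i\<in>I. (norm (n *\<^sub>R z i - S))\<^sup>2) = 0"
    by (intro antisym sum_nonneg) auto
  then have "\<forall>i\<in>I. (norm (n *\<^sub>R z i - S))\<^sup>2 = 0"
    using I by (subst (asm) sum_nonneg_eq_0_iff) auto
  then show ?thesis using i by (simp add: n_def S_def)
qed

context group
begin

lemma conj_class_subset: "t \<in> carrier G \<Longrightarrow> conj_class t \<subseteq> carrier G"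
  by (auto simp: conj_class_def)

lemma finite_conj_class: "finite (carrier G) \<Longrightarrow> finite (conj_class t)"
  by (simp add: conj_class_def)

lemma self_in_conj_class: "t \<in> carrier G \<Longrightarrow> t \<in> conj_class t"
  by (auto simp: conj_class_def image_iff intro!: bexI[of _ \<one>])

lemma conj_mem_conj_class:
  assumes "t \<in> carrier G" "c \<in> conj_class t" "g \<in> carrier G"
  shows "g \<otimes> c \<otimes> inv g \<in> conj_class t"
proof -
  obtain h where h: "h \<in> carrier G" "c = h \<otimes> t \<otimes> inv h"
    using assms by (auto simp: conj_class_def)
  then have "g \<otimes> c \<otimes> inv g = (g \<otimes> h) \<otimes> t \<otimes> inv (g \<otimes> h)"
    using assms by (simp add: m_assoc inv_mult_group)
  then show ?thesis using assms h unfolding conj_class_def by blast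
qed

lemma conj_mem_conj_class_iff:
  assumes "t \<in> carrier G" "g \<in> carrier G" "x \<in> carrier G"
  shows "g \<otimes> x \<otimes> inv g \<in> conj_class t \<longleftrightarrow> x \<in> conj_class t"
proof
  assume "g \<otimes> x \<otimes> inv g \<in> conj_class t"
  from conj_mem_conj_class[OF assms(1) this, of "inv g"] show "x \<in> conj_class t"
    using assms by (simp add: m_assoc)
qed (use assms conj_mem_conj_class in auto)

lemma one_mem_conj_class_iff: "t \<in> carrier G \<Longrightarrow> \<one> \<in> conj_class t \<longleftrightarrow> t = \<one>"
  by (auto simp: conj_class_def image_iff conj_eq_iff_commute inv_solve_right intro!: bexI[of _ \<one>])

lemma conj_class_involution:
  assumes "t \<in> carrier G" "t \<otimes> t = \<one>" "c \<in> conj_class t"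
  shows "inv c = c"
proof -
  obtain h where h: "h \<in> carrier G" "c = h \<otimes> t \<otimes> inv h"
    using assms by (auto simp: conj_class_def)
  have "inv t = t" using assms inv_equality by blast
  then show ?thesis using h assms(1) by (simp add: inv_mult_group m_assoc)
qed

lemma sum_carrier_mult_right:
  assumes "g \<in> carrier G"
  shows "(\<Sum>x\<in>carrier G. f (x \<otimes> g)) = (\<Sum>x\<in>carrier G. f x)"
  by (rule sum.reindex_bij_witness[of _ "\<lambda>x. x \<otimes> inv g" "\<lambda>x. x \<otimes> g"])
    (use assms in \<open>auto simp: m_assoc\<close>)

lemma sum_conj_class_conj:
  assumes t: "t \<in> carrier G" and x: "x \<in> carrier G"
  shows "(\<Sum>c\<in>conj_class t. f (x \<otimes> c \<otimes> inv x)) = (\<Sum>c\<in>conj_class t. f c)"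
proof (rule sum.reindex_bij_witness[of _ "\<lambda>c. inv x \<otimes> c \<otimes> x" "\<lambda>c. x \<otimes> c \<otimes> inv x"])
  fix c assume c: "c \<in> conj_class t"
  then have "c \<in> carrier G" using conj_class_subset[OF t] by auto
  then show "inv x \<otimes> (x \<otimes> c \<otimes> inv x) \<otimes> x = c" "x \<otimes> (inv x \<otimes> c \<otimes> x) \<otimes> inv x = c"
    using x by (auto simp: m_assoc)
  show "x \<otimes> c \<otimes> inv x \<in> conj_class t" using conj_mem_conj_class[OF t c x] .
  show "inv x \<otimes> c \<otimes> x \<in> conj_class t" using conj_mem_conj_class[OF t c, of "inv x"] x by simp
qed simp

lemma sum_conjugates:
  fixes f :: "'a \<Rightarrow> 'c :: semiring_1"
  assumes t: "t \<in> carrier G"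
  shows "of_nat (card (conj_class t)) * (\<Sum>x\<in>carrier G. f (x \<otimes> t \<otimes> inv x)) =
    of_nat (order G) * (\<Sum>c\<in>conj_class t. f c)"
proof -
  have "(\<Sum>x\<in>carrier G. f (x \<otimes> c \<otimes> inv x)) = (\<Sum>x\<in>carrier G. f (x \<otimes> t \<otimes> inv x))"
    if c: "c \<in> conj_class t" for c
  proof -
    obtain g where g: "g \<in> carrier G" "c = g \<otimes> t \<otimes> inv g"
      using c by (auto simp: conj_class_def)
    have "(\<Sum>x\<in>carrier G. f (x \<otimes> c \<otimes> inv x)) =
        (\<Sum>x\<in>carrier G. f ((x \<otimes> g) \<otimes> t \<otimes> inv (x \<otimes> g)))"
      using g t by (intro sum.cong) (auto simp: m_assoc inv_mult_group)
    also have "\<dots> = (\<Sum>x\<in>carrier G. f (x \<otimes> t \<otimes> inv x))"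
      by (rule sum_carrier_mult_right[OF g(1), of "\<lambda>x. f (x \<otimes> t \<otimes> inv x)"])
    finally show ?thesis .
  qed
  then have "of_nat (card (conj_class t)) * (\<Sum>x\<in>carrier G. f (x \<otimes> t \<otimes> inv x)) =
      (\<Sum>c\<in>conj_class t. \<Sum>x\<in>carrier G. f (x \<otimes> c \<otimes> inv x))"
    by simp
  also have "\<dots> = (\<Sum>x\<in>carrier G. \<Sum>c\<in>conj_class t. f (x \<otimes> c \<otimes> inv x))"
    by (rule sum.swap)
  also have "\<dots> = of_nat (order G) * (\<Sum>c\<in>conj_class t. f c)"
    by (simp add: sum_conj_class_conj[OF t] order_def)
  finally show ?thesis .
qed

definition class_kernel :: "'a \<Rightarrow> 'a \<Rightarrow> 'a \<Rightarrow> complex" where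
  "class_kernel t x y = of_bool (x \<otimes> inv y \<in> conj_class t)"

text \<open>Subtracting the constant projects away the constant functions, on which the class sum acts as
  \<open>card (conj_class t)\<close>.\<close>

definition reduced_class_kernel :: "'a \<Rightarrow> 'a \<Rightarrow> 'a \<Rightarrow> complex" where
  "reduced_class_kernel t x y = class_kernel t x y - of_nat (card (conj_class t)) / of_nat (order G)"

abbreviation reduced_class_pow :: "'a \<Rightarrow> nat \<Rightarrow> 'a \<Rightarrow> 'a \<Rightarrow> complex" where
  "reduced_class_pow t \<equiv> kernel_pow (carrier G) (reduced_class_kernel t)"

context
  fixes t
  assumes fin: "finite (carrier G)" and t: "t \<in> carrier G"
begin

lemma card_conj_class_pos: "card (conj_class t) > 0"
  using finite_conj_class[OF fin] self_in_conj_class[OF t] by (auto simp: card_gt_0_iff)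

lemma sum_mult_class_kernel:
  assumes "y \<in> carrier G"
  shows "(\<Sum>x\<in>carrier G. v x * class_kernel t x y) = (\<Sum>c\<in>conj_class t. v (c \<otimes> y))"
proof -
  have "(\<Sum>x\<in>carrier G. v x * class_kernel t x y) =
      (\<Sum>x\<in>carrier G \<inter> {x. x \<otimes> inv y \<in> conj_class t}. v x)"
    using fin by (simp add: class_kernel_def sum_mult_of_bool_eq)
  also have "\<dots> = (\<Sum>c\<in>conj_class t. v (c \<otimes> y))"
    by (rule sum.reindex_bij_witness[of _ "\<lambda>c. c \<otimes> y" "\<lambda>x. x \<otimes> inv y"])
      (use assms conj_class_subset[OF t] in \<open>auto simp: m_assoc subset_iff\<close>)
  finally show ?thesis .
qed

lemma sum_class_kernel_mult:
  assumes x: "x \<in> carrier G"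
  shows "(\<Sum>y\<in>carrier G. class_kernel t x y * v y) = (\<Sum>c\<in>conj_class t. v (inv c \<otimes> x))"
proof -
  have "(\<Sum>y\<in>carrier G. class_kernel t x y * v y) =
      (\<Sum>y\<in>carrier G \<inter> {y. x \<otimes> inv y \<in> conj_class t}. v y)"
    using fin by (simp add: class_kernel_def sum_of_bool_mult_eq)
  also have "\<dots> = (\<Sum>c\<in>conj_class t. v (inv c \<otimes> x))"
    by (rule sum.reindex_bij_witness[of _ "\<lambda>c. inv c \<otimes> x" "\<lambda>y. x \<otimes> inv y"])
      (use x conj_class_subset[OF t] in \<open>auto simp: m_assoc inv_mult_group subset_iff\<close>)
  finally show ?thesis .
qed

lemma sum_reduced_class_kernel_row:
  assumes "x \<in> carrier G"
  shows "(\<Sum>y\<in>carrier G. reduced_class_kernel t x y) = 0"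
  using sum_class_kernel_mult[OF assms, of "\<lambda>_. 1"] assms fin
  by (auto simp: reduced_class_kernel_def sum_subtractf order_def)

lemma sum_reduced_class_kernel_column:
  assumes "y \<in> carrier G"
  shows "(\<Sum>x\<in>carrier G. reduced_class_kernel t x y) = 0"
  using sum_mult_class_kernel[OF assms, of "\<lambda>_. 1"] assms fin
  by (auto simp: reduced_class_kernel_def sum_subtractf order_def)

lemma reduced_class_kernel_mult_right:
  assumes "x \<in> carrier G" "y \<in> carrier G" "h \<in> carrier G"
  shows "reduced_class_kernel t (x \<otimes> h) (y \<otimes> h) = reduced_class_kernel t x y"
  using assms by (simp add: reduced_class_kernel_def class_kernel_def m_assoc inv_mult_group)

lemma reduced_class_pow_mult_right:
  assumes "x \<in> carrier G" "y \<in> carrier G" "h \<in> carrier G"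
  shows "reduced_class_pow t j (x \<otimes> h) (y \<otimes> h) = reduced_class_pow t j x y"
proof (rule kernel_pow_invariant[where s = "\<lambda>x. x \<otimes> h"])
  show "bij_betw (\<lambda>x. x \<otimes> h) (carrier G) (carrier G)"
    by (rule bij_betwI[where g = "\<lambda>x. x \<otimes> inv h"]) (use assms in \<open>auto simp: m_assoc\<close>)
qed (use assms reduced_class_kernel_mult_right in auto)

lemma reduced_class_kernel_mult_left:
  assumes "x \<in> carrier G" "y \<in> carrier G" "h \<in> carrier G"
  shows "reduced_class_kernel t (h \<otimes> x) (h \<otimes> y) = reduced_class_kernel t x y"
proof -
  have "(h \<otimes> x) \<otimes> inv (h \<otimes> y) = h \<otimes> (x \<otimes> inv y) \<otimes> inv h"
    using assms by (simp add: m_assoc inv_mult_group)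
  then show ?thesis
    using conj_mem_conj_class_iff[OF t, of h "x \<otimes> inv y"] assms
    by (simp add: reduced_class_kernel_def class_kernel_def)
qed

lemma reduced_class_pow_mult_left:
  assumes "x \<in> carrier G" "y \<in> carrier G" "h \<in> carrier G"
  shows "reduced_class_pow t j (h \<otimes> x) (h \<otimes> y) = reduced_class_pow t j x y"
proof (rule kernel_pow_invariant[where s = "\<lambda>x. h \<otimes> x"])
  show "bij_betw (\<lambda>x. h \<otimes> x) (carrier G) (carrier G)"
    by (rule bij_betwI[where g = "\<lambda>x. inv h \<otimes> x"]) (use assms in auto)
qed (use assms reduced_class_kernel_mult_left in auto)

lemma kernel_trace_reduced_class_pow:
  "kernel_trace (carrier G) (reduced_class_pow t j) = of_nat (order G) * reduced_class_pow t j \<one> \<one>"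
proof -
  have "reduced_class_pow t j x x = reduced_class_pow t j \<one> \<one>" if "x \<in> carrier G" for x
    using reduced_class_pow_mult_right[of \<one> \<one> x j] that by simp
  then have "(\<Sum>x\<in>carrier G. reduced_class_pow t j x x) = (\<Sum>x\<in>carrier G. reduced_class_pow t j \<one> \<one>)"
    by (rule sum.cong[OF refl])
  then show ?thesis by (simp add: kernel_trace_def order_def)
qed

lemma sum_reduced_class_pow_row:
  assumes "x \<in> carrier G"
  shows "(\<Sum>y\<in>carrier G. reduced_class_pow t (Suc j) x y) = 0"
proof -
  have "(\<Sum>y\<in>carrier G. reduced_class_pow t (Suc j) x y) =
      (\<Sum>z\<in>carrier G. reduced_class_pow t j x z * (\<Sum>y\<in>carrier G. reduced_class_kernel t z y))"
    unfolding kernel_pow.simps sum_distrib_left by (rule sum.swap)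
  then show ?thesis using sum_reduced_class_kernel_row by simp
qed

lemma reduced_class_pow_one_right:
  assumes x: "x \<in> carrier G"
  shows "reduced_class_pow t (Suc (Suc j)) x \<one> =
    (\<Sum>c\<in>conj_class t. reduced_class_pow t (Suc j) x c)"
proof -
  let ?P = "reduced_class_pow t (Suc j) x"
  let ?r = "of_nat (card (conj_class t)) / of_nat (order G) :: complex"
  have "reduced_class_pow t (Suc (Suc j)) x \<one> =
      (\<Sum>z\<in>carrier G. ?P z * class_kernel t z \<one>) - (\<Sum>z\<in>carrier G. ?P z) * ?r"
    unfolding kernel_pow.simps(2)[of _ _ "Suc j"] sum_distrib_right sum_subtractf[symmetric]
    by (simp only: reduced_class_kernel_def right_diff_distrib)
  also have "(\<Sum>z\<in>carrier G. ?P z) = 0"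
    by (rule sum_reduced_class_pow_row[OF x])
  also have "(\<Sum>z\<in>carrier G. ?P z * class_kernel t z \<one>) = (\<Sum>c\<in>conj_class t. ?P (c \<otimes> \<one>))"
    by (rule sum_mult_class_kernel) simp
  also have "\<dots> = (\<Sum>c\<in>conj_class t. ?P c)"
    using conj_class_subset[OF t] by (intro sum.cong) auto
  finally show ?thesis by simp
qed

lemma reduced_class_pow_one_one:
  "reduced_class_pow t (Suc (Suc j)) \<one> \<one> =
    of_nat (card (conj_class t)) * reduced_class_pow t (Suc j) \<one> t"
proof -
  let ?P = "reduced_class_pow t (Suc j)"
  have "?P \<one> c = ?P \<one> t" if c: "c \<in> conj_class t" for c
  proof -
    obtain g where g: "g \<in> carrier G" "c = g \<otimes> t \<otimes> inv g" using c by (auto simp: conj_class_def)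
    have "?P \<one> c = ?P (g \<otimes> \<one> \<otimes> inv g) (g \<otimes> t \<otimes> inv g)" using g by simp
    also have "\<dots> = ?P (g \<otimes> \<one>) (g \<otimes> t)"
      using g(1) t by (intro reduced_class_pow_mult_right) auto
    also have "\<dots> = ?P \<one> t"
      using g(1) t by (intro reduced_class_pow_mult_left) auto
    finally show ?thesis .
  qed
  then show ?thesis by (simp add: reduced_class_pow_one_right)
qed

context
  assumes involution: "t \<otimes> t = \<one>"
begin

lemma twisted_trace_mult_left:
  "(\<Sum>x\<in>carrier G. reduced_class_pow t (Suc j) (t \<otimes> x) x) =
    1 / of_nat (card (conj_class t)) *
      kernel_trace (carrier G) (reduced_class_pow t (Suc j + 1))"
proof -
  let ?P = "reduced_class_pow t (Suc j)"
  have "?P (t \<otimes> x) x = ?P \<one> t" if "x \<in> carrier G" for x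
    using that t involution reduced_class_pow_mult_right[of t \<one> x "Suc j"]
      reduced_class_pow_mult_left[of \<one> t t "Suc j"] by simp
  then show ?thesis
    using reduced_class_pow_one_one[of j] card_conj_class_pos
    by (simp add: kernel_trace_reduced_class_pow order_def)
qed

lemma twisted_trace_conj:
  "(\<Sum>x\<in>carrier G. reduced_class_pow t (Suc j) (t \<otimes> x \<otimes> t) x) =
    1 / (of_nat (card (conj_class t)))\<^sup>2 *
      kernel_trace (carrier G) (reduced_class_pow t (Suc j + 2))"
proof -
  let ?P = "reduced_class_pow t"
  let ?q = "of_nat (card (conj_class t)) :: complex"
  have "?P (Suc j) (t \<otimes> x \<otimes> t) x = ?P (Suc j) t (x \<otimes> t \<otimes> inv x)" if x: "x \<in> carrier G" for x
  proof -
    have "t \<otimes> (t \<otimes> inv x) = inv x" using t x involution by (simp flip: m_assoc)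
    then have "(t \<otimes> x \<otimes> t) \<otimes> (t \<otimes> inv x) = t" "x \<otimes> (t \<otimes> inv x) = x \<otimes> t \<otimes> inv x"
      using t x by (simp_all add: m_assoc)
    then show ?thesis
      using reduced_class_pow_mult_right[of "t \<otimes> x \<otimes> t" x "t \<otimes> inv x" "Suc j"] t x by simp
  qed
  then have "?q * (\<Sum>x\<in>carrier G. ?P (Suc j) (t \<otimes> x \<otimes> t) x) =
      of_nat (order G) * (\<Sum>c\<in>conj_class t. ?P (Suc j) t c)"
    using sum_conjugates[OF t, of "?P (Suc j) t"] by simp
  also have "(\<Sum>c\<in>conj_class t. ?P (Suc j) t c) = ?P (Suc (Suc j)) (t \<otimes> \<one>) (t \<otimes> t)"
    using reduced_class_pow_one_right[OF t, of j] t involution by simp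
  also have "\<dots> = ?P (Suc (Suc j)) \<one> t"
    using t by (intro reduced_class_pow_mult_left) auto
  finally have "?q\<^sup>2 * (\<Sum>x\<in>carrier G. ?P (Suc j) (t \<otimes> x \<otimes> t) x) =
      of_nat (order G) * ?P (Suc j + 2) \<one> \<one>"
    using reduced_class_pow_one_one[of "Suc j"]
    by (simp add: power2_eq_square mult_ac)
  then show ?thesis
    using card_conj_class_pos
    by (simp add: kernel_trace_reduced_class_pow field_simps)
qed

lemma class_multiplicity_in_Ints:
  assumes m: "kernel_spectrum (carrier G) (reduced_class_kernel t) m" and l: "m l \<noteq> 0" "l \<noteq> 0"
  shows "of_nat (m l) * l / of_nat (card (conj_class t)) \<in> \<int>"
    and "of_nat (m l) * l\<^sup>2 / (of_nat (card (conj_class t)))\<^sup>2 \<in> \<int>"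
proof -
  have cancel: "t \<otimes> (t \<otimes> x) = x" if "x \<in> carrier G" for x
    using that t involution by (simp flip: m_assoc)
  have "1 / of_nat (card (conj_class t)) * of_nat (m l) * l ^ 1 \<in> \<int>"
    by (rule twisted_multiplicity_in_Ints[where s = "\<lambda>x. t \<otimes> x", OF fin _ _ _ m twisted_trace_mult_left l])
      (use t cancel reduced_class_kernel_mult_left in auto)
  then show "of_nat (m l) * l / of_nat (card (conj_class t)) \<in> \<int>" by simp
  have "1 / (of_nat (card (conj_class t)))\<^sup>2 * of_nat (m l) * l\<^sup>2 \<in> \<int>"
  proof (rule twisted_multiplicity_in_Ints[where s = "\<lambda>x. t \<otimes> x \<otimes> t", OF fin _ _ _ m twisted_trace_conj l])
    show "reduced_class_kernel t (t \<otimes> x \<otimes> t) (t \<otimes> y \<otimes> t) = reduced_class_kernel t x y"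
      if "x \<in> carrier G" "y \<in> carrier G" for x y
      using that t reduced_class_kernel_mult_right reduced_class_kernel_mult_left by simp
  qed (use t cancel involution in \<open>auto simp: m_assoc\<close>)
  then show "of_nat (m l) * l\<^sup>2 / (of_nat (card (conj_class t)))\<^sup>2 \<in> \<int>" by simp
qed

end

text \<open>Where \<open>norm w\<close> is maximal, \<open>norm l \<ge> card (conj_class t)\<close> leaves no room in the triangle inequality,
  so that \<open>w (c \<otimes> x)\<close> does not depend on \<open>c\<close>.\<close>

context
  fixes w :: "'a \<Rightarrow> complex" and l :: complex
  assumes eigen: "\<And>x. x \<in> carrier G \<Longrightarrow> (\<Sum>c\<in>conj_class t. w (c \<otimes> x)) = l * w x"
    and l: "real (card (conj_class t)) \<le> norm l"
begin

lemma class_eigenfunction_at_maximum: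
  assumes x: "x \<in> carrier G" "\<And>y. y \<in> carrier G \<Longrightarrow> norm (w y) \<le> norm (w x)"
    and c: "c \<in> conj_class t"
  shows "of_nat (card (conj_class t)) * w (c \<otimes> x) = l * w x" "norm (w (c \<otimes> x)) = norm (w x)"
proof -
  have C: "c \<in> carrier G" if "c \<in> conj_class t" for c using conj_class_subset[OF t] that by auto
  have "real (card (conj_class t)) * norm (w x) \<le> norm (\<Sum>c\<in>conj_class t. w (c \<otimes> x))"
    using l by (simp add: eigen[OF x(1)] norm_mult mult_right_mono)
  then have "real (card (conj_class t)) *\<^sub>R w (c \<otimes> x) = l * w x"
    using eq_mean_if_norm_le[of "conj_class t" "\<lambda>c. w (c \<otimes> x)" "norm (w x)" c]
      finite_conj_class[OF fin] x C c by (simp add: eigen)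
  then show mean: "of_nat (card (conj_class t)) * w (c \<otimes> x) = l * w x"
    by (simp add: scaleR_conv_of_real)
  have "real (card (conj_class t)) * norm (w (c \<otimes> x)) = norm l * norm (w x)"
    using arg_cong[OF mean, of norm] by (simp add: norm_mult)
  then have "real (card (conj_class t)) * norm (w x) \<le> real (card (conj_class t)) * norm (w (c \<otimes> x))"
    using l by (simp add: mult_right_mono)
  then show "norm (w (c \<otimes> x)) = norm (w x)"
    using x(2)[of "c \<otimes> x"] C[OF c] x(1) card_conj_class_pos by (intro antisym) auto
qed

context
  assumes involution: "t \<otimes> t = \<one>"
begin

lemma class_eigenfunction_product_at_maximum:
  assumes x: "x \<in> carrier G" "\<And>y. y \<in> carrier G \<Longrightarrow> norm (w y) \<le> norm (w x)"
    and c: "c \<in> conj_class t" and d: "d \<in> conj_class t"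
  shows "w (c \<otimes> (d \<otimes> x)) = w x"
proof -
  let ?q = "of_nat (card (conj_class t)) :: complex"
  have d_carrier: "d \<in> carrier G" using conj_class_subset[OF t] d by auto
  note dx = class_eigenfunction_at_maximum[OF x d]
  have square: "?q\<^sup>2 * w (c \<otimes> (d \<otimes> x)) = l\<^sup>2 * w x" if c: "c \<in> conj_class t" for c
  proof -
    have "?q\<^sup>2 * w (c \<otimes> (d \<otimes> x)) = ?q * (l * w (d \<otimes> x))"
      using class_eigenfunction_at_maximum(1)[of "d \<otimes> x" c] x d_carrier dx(2) c
      by (simp add: power2_eq_square)
    also have "\<dots> = l * (l * w x)" using dx(1) by (simp add: mult.left_commute)
    finally show ?thesis by (simp add: power2_eq_square)
  qed
  have "d \<otimes> (d \<otimes> x) = x"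
    using inv_mult_cancel(1)[of d x] conj_class_involution[OF t involution d] d_carrier x(1) by simp
  then have "?q\<^sup>2 * w x = l\<^sup>2 * w x" using square[OF d] by simp
  then have "?q\<^sup>2 * w (c \<otimes> (d \<otimes> x)) = ?q\<^sup>2 * w x" using square[OF c] by metis
  then show ?thesis using card_conj_class_pos by simp
qed

lemma class_eigenfunction_invariant_at_maximum:
  assumes "h \<in> generate G (conj_class t <#> conj_class t)"
    and "x \<in> carrier G" "\<And>y. y \<in> carrier G \<Longrightarrow> norm (w y) \<le> norm (w x)"
  shows "w (h \<otimes> x) = w x"
  using assms
proof (induction h arbitrary: x)
  case (incl h)
  then obtain c d where cd: "c \<in> conj_class t" "d \<in> conj_class t" "h = c \<otimes> d"
    by (auto simp: set_mult_def)
  then have "c \<in> carrier G" "d \<in> carrier G" using conj_class_subset[OF t] by auto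
  then show ?case
    using class_eigenfunction_product_at_maximum[OF incl(2,3) cd(1,2)] cd(3) incl(2) by (simp add: m_assoc)
next
  case (inv h)
  then obtain c d where cd: "c \<in> conj_class t" "d \<in> conj_class t" "h = c \<otimes> d"
    by (auto simp: set_mult_def)
  then have "c \<in> carrier G" "d \<in> carrier G" using conj_class_subset[OF t] by auto
  moreover have "inv c = c" "inv d = d" using conj_class_involution[OF t involution] cd by auto
  ultimately show ?case
    using class_eigenfunction_product_at_maximum[OF inv(2,3) cd(2,1)] cd(3) inv(2)
    by (simp add: m_assoc inv_mult_group)
next
  case (eng h1 h2)
  have "conj_class t <#> conj_class t \<subseteq> carrier G"
    using conj_class_subset[OF t] by (auto simp: set_mult_def)
  then have h: "h1 \<in> carrier G" "h2 \<in> carrier G"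
    using eng(1,2) generate_in_carrier by blast+
  have h2: "w (h2 \<otimes> x) = w x" using eng by blast
  then have "w (h1 \<otimes> (h2 \<otimes> x)) = w (h2 \<otimes> x)"
    using eng.IH(1)[of "h2 \<otimes> x"] eng.prems h by simp
  then show ?case using h h2 eng.prems(1) by (simp add: m_assoc)
qed simp

end

end

lemma reduced_class_kernel_eigenvector:
  assumes "kernel_eigenvalue (carrier G) (reduced_class_kernel t) l" "l \<noteq> 0"
  obtains v x where "x \<in> carrier G" "v x \<noteq> 0" "(\<Sum>x\<in>carrier G. v x) = 0"
    "\<And>x. x \<in> carrier G \<Longrightarrow> (\<Sum>y\<in>carrier G. class_kernel t x y * v y) = l * v x"
proof -
  obtain v x where v: "x \<in> carrier G" "v x \<noteq> 0"
      "\<And>x. x \<in> carrier G \<Longrightarrow> (\<Sum>y\<in>carrier G. reduced_class_kernel t x y * v y) = l * v x"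
    using assms(1) unfolding kernel_eigenvalue_def by blast
  have "l * (\<Sum>x\<in>carrier G. v x) =
      (\<Sum>x\<in>carrier G. \<Sum>y\<in>carrier G. reduced_class_kernel t x y * v y)"
    using v(3) by (simp add: sum_distrib_left)
  also have "\<dots> = (\<Sum>y\<in>carrier G. (\<Sum>x\<in>carrier G. reduced_class_kernel t x y) * v y)"
    by (subst sum.swap) (simp add: sum_distrib_right)
  finally have sum_v: "(\<Sum>x\<in>carrier G. v x) = 0"
    using sum_reduced_class_kernel_column assms(2) by simp
  have "(\<Sum>y\<in>carrier G. class_kernel t x y * v y) = l * v x" if "x \<in> carrier G" for x
  proof -
    let ?r = "of_nat (card (conj_class t)) / of_nat (order G)"
    have "(\<Sum>y\<in>carrier G. class_kernel t x y * v y) =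
        (\<Sum>y\<in>carrier G. reduced_class_kernel t x y * v y) + ?r * (\<Sum>y\<in>carrier G. v y)"
      unfolding sum_distrib_left sum.distrib[symmetric]
      by (intro sum.cong) (auto simp: reduced_class_kernel_def algebra_simps)
    then show ?thesis using v(3)[OF that] sum_v by simp
  qed
  then show ?thesis using that v(1,2) sum_v by blast
qed

lemma reduced_class_kernel_eigenvalue_algebraic_int:
  assumes "kernel_eigenvalue (carrier G) (reduced_class_kernel t) l" "l \<noteq> 0"
  shows "algebraic_int l"
proof (rule integral_kernel_eigenvalue_algebraic_int[OF fin])
  show "kernel_eigenvalue (carrier G) (class_kernel t) l"
    using assms by (rule reduced_class_kernel_eigenvector) (auto simp: kernel_eigenvalue_def)
qed (simp add: class_kernel_def)

end

end

lemma prime_dvd_of_abs_less_prime_power: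
  fixes a b k :: int and m p :: nat
  assumes p: "prime p"
    and a: "int m * k = int p ^ c * a" and b: "int m * k\<^sup>2 = (int p ^ c)\<^sup>2 * b"
    and k: "k \<noteq> 0" "\<bar>k\<bar> < int p ^ c"
  shows "int p dvd a"
proof (rule ccontr)
  assume not_dvd: "\<not> int p dvd a"
  have "(int p ^ c)\<^sup>2 * a\<^sup>2 = (int m * k) * (int m * k)"
    unfolding a by (simp add: power2_eq_square)
  also have "\<dots> = int m * (int m * k\<^sup>2)" by (simp add: power2_eq_square)
  also have "\<dots> = (int p ^ c)\<^sup>2 * (int m * b)" unfolding b by simp
  finally have "a\<^sup>2 = int m * b" using p by (simp add: prime_gt_0_nat)
  then have "\<not> int p dvd int m"
    using not_dvd p prime_dvd_power[of "int p" a 2] by (auto dest: dvd_mult2)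
  then have "coprime (int p ^ c) (int m)"
    using p by (intro coprime_power_left_iff[THEN iffD2] disjI1 prime_imp_coprime) auto
  then have "int p ^ c dvd k"
    using a by (metis coprime_dvd_mult_right_iff dvd_triv_left)
  then show False
    using k zdvd_imp_le[of "int p ^ c" "\<bar>k\<bar>"] by auto
qed

context simple_group
begin

lemma finite_carrier: "finite (carrier G)"
  using order_gt_one order_gt_0_iff_finite by simp

lemma generate_conj_class_products:
  assumes t: "t \<in> carrier G" "t \<otimes> t = \<one>" and card: "card (conj_class t) > 1"
  shows "generate G (conj_class t <#> conj_class t) = carrier G"
proof -
  let ?C = "conj_class t"
  have C: "c \<in> carrier G" if "c \<in> ?C" for c using conj_class_subset[OF t(1)] that by auto
  have "generate G (?C <#> ?C) \<lhd> G"
  proof (rule normal_generateI)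
    show "?C <#> ?C \<subseteq> carrier G" using C by (auto simp: set_mult_def)
    fix h g assume "h \<in> ?C <#> ?C" and g: "g \<in> carrier G"
    then obtain c d where cd: "c \<in> ?C" "d \<in> ?C" "h = c \<otimes> d" by (auto simp: set_mult_def)
    have "g \<otimes> h \<otimes> inv g = (g \<otimes> c \<otimes> inv g) \<otimes> (g \<otimes> d \<otimes> inv g)"
      using cd C g by (simp add: m_assoc)
    then show "g \<otimes> h \<otimes> inv g \<in> ?C <#> ?C"
      using conj_mem_conj_class[OF t(1)] cd g by (auto simp: set_mult_def)
  qed
  moreover have "generate G (?C <#> ?C) \<noteq> {\<one>}"
  proof
    assume trivial: "generate G (?C <#> ?C) = {\<one>}"
    have "\<not> ?C \<subseteq> {t}" using card card_mono[of "{t}" ?C] by auto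
    then obtain d where d: "d \<in> ?C" "d \<noteq> t" by blast
    have "d \<otimes> t \<in> generate G (?C <#> ?C)"
      using d self_in_conj_class[OF t(1)] by (intro generate.incl) (auto simp: set_mult_def)
    then have "d \<otimes> t = t \<otimes> t" using trivial t(2) by simp
    then show False using d C t(1) by simp
  qed
  ultimately show ?thesis using no_real_normal_subgroup by blast
qed

lemma norm_class_eigenvalue_less:
  fixes w :: "'a \<Rightarrow> complex"
  assumes t: "t \<in> carrier G" "t \<otimes> t = \<one>" and card: "card (conj_class t) > 1"
    and eigen: "\<And>x. x \<in> carrier G \<Longrightarrow> (\<Sum>c\<in>conj_class t. w (c \<otimes> x)) = l * w x"
    and sum_w: "(\<Sum>x\<in>carrier G. w x) = 0" and nonzero: "x \<in> carrier G" "w x \<noteq> 0"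
  shows "norm l < real (card (conj_class t))"
proof (rule ccontr)
  assume "\<not> ?thesis"
  then have l: "real (card (conj_class t)) \<le> norm l" by simp
  have "Max ((\<lambda>x. norm (w x)) ` carrier G) \<in> (\<lambda>x. norm (w x)) ` carrier G"
    using finite_carrier nonzero(1) by (intro Max_in) auto
  then obtain x0 where x0: "x0 \<in> carrier G" "norm (w x0) = Max ((\<lambda>x. norm (w x)) ` carrier G)"
    by auto
  then have maximal: "norm (w y) \<le> norm (w x0)" if "y \<in> carrier G" for y
    using finite_carrier that by simp
  have "w x = w x0" if x: "x \<in> carrier G" for x
  proof -
    have "x \<otimes> inv x0 \<in> generate G (conj_class t <#> conj_class t)"
      using generate_conj_class_products[OF t card] x x0(1) by simp
    then have "w ((x \<otimes> inv x0) \<otimes> x0) = w x0"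
      using class_eigenfunction_invariant_at_maximum[OF finite_carrier t(1) eigen l t(2) _ x0(1) maximal] by blast
    then show ?thesis using x x0(1) by (simp add: m_assoc)
  qed
  then have "(\<Sum>x\<in>carrier G. w x) = of_nat (order G) * w x0" by (simp add: order_def)
  moreover have "w x0 \<noteq> 0" using maximal[OF nonzero(1)] nonzero(2) by auto
  ultimately show False using sum_w finite_carrier order_gt_0_iff_finite by auto
qed

lemma rational_class_eigenvalue:
  assumes t: "t \<in> carrier G" "t \<otimes> t = \<one>" and card: "card (conj_class t) > 1"
    and eigenvalue: "kernel_eigenvalue (carrier G) (reduced_class_kernel t) l"
    and l: "l \<noteq> 0" "l \<in> \<rat>"
  obtains k :: int where "l = of_int k" "\<bar>k\<bar> < int (card (conj_class t))"
proof -
  have "l \<in> \<int>"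
    using rational_algebraic_int_is_int
      reduced_class_kernel_eigenvalue_algebraic_int[OF finite_carrier t(1) eigenvalue l(1)] l(2) by blast
  then obtain k where k: "l = of_int k" by (auto elim: Ints_cases)
  obtain v x where v: "x \<in> carrier G" "v x \<noteq> 0" "(\<Sum>x\<in>carrier G. v x) = 0"
      "\<And>x. x \<in> carrier G \<Longrightarrow> (\<Sum>y\<in>carrier G. class_kernel t x y * v y) = l * v x"
    by (rule reduced_class_kernel_eigenvector[OF finite_carrier t(1) eigenvalue l(1)]) (rule that)
  have "(\<Sum>c\<in>conj_class t. v (c \<otimes> x)) = l * v x" if "x \<in> carrier G" for x
    using v(4)[OF that] sum_class_kernel_mult[OF finite_carrier t(1) that, of v] conj_class_involution[OF t]
    by simp
  then have "norm l < real (card (conj_class t))"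
    using norm_class_eigenvalue_less[OF t card _ v(3,1,2)] by blast
  then have "real_of_int \<bar>k\<bar> < of_int (int (card (conj_class t)))" by (simp add: k)
  then have "\<bar>k\<bar> < int (card (conj_class t))" by (simp only: of_int_less_iff)
  then show ?thesis using that k by blast
qed

lemma prime_dvd_class_multiplicity:
  assumes t: "t \<in> carrier G" "t \<otimes> t = \<one>"
    and p: "prime p" and card: "card (conj_class t) = p ^ c" "c > 0"
    and m: "kernel_spectrum (carrier G) (reduced_class_kernel t) m" and l: "m l \<noteq> 0"
  shows "\<exists>a. of_nat (m l) * l = of_nat (card (conj_class t)) * of_int (int p * a)"
proof (cases "l = 0")
  case False
  let ?q = "card (conj_class t)"
  have q: "?q > 1" using card one_less_power[OF prime_gt_1_nat[OF p]] by simp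
  obtain a where a: "of_nat (m l) * l = of_nat ?q * of_int a"
    using class_multiplicity_in_Ints(1)[OF finite_carrier t m l False] q
    by (auto elim!: Ints_cases simp: field_simps)
  obtain b where b: "of_nat (m l) * l\<^sup>2 = (of_nat ?q)\<^sup>2 * of_int b"
    using class_multiplicity_in_Ints(2)[OF finite_carrier t m l False] q
    by (auto elim!: Ints_cases simp: field_simps)
  have "l = of_int (int ?q * a) / of_int (int (m l))" using a l by (simp add: field_simps)
  then have "l \<in> \<rat>" by (metis Rats_divide Rats_of_int)
  moreover have "kernel_eigenvalue (carrier G) (reduced_class_kernel t) l"
    using m l by (simp add: kernel_spectrum_def)
  ultimately obtain k where k: "l = of_int k" "\<bar>k\<bar> < int p ^ c"
    using rational_class_eigenvalue[OF t q _ False] card(1) by (metis of_nat_power)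
  have "(of_int (int (m l) * k) :: complex) = of_int (int p ^ c * a)"
    using a by (simp add: k(1) card(1))
  then have "int (m l) * k = int p ^ c * a" by (simp only: of_int_eq_iff)
  moreover have "(of_int (int (m l) * k\<^sup>2) :: complex) = of_int ((int p ^ c)\<^sup>2 * b)"
    using b by (simp add: k(1) card(1))
  then have "int (m l) * k\<^sup>2 = (int p ^ c)\<^sup>2 * b" by (simp only: of_int_eq_iff)
  ultimately have "int p dvd a"
    using prime_dvd_of_abs_less_prime_power[OF p] False k by simp
  then show ?thesis using a by (auto elim!: dvdE)
qed (auto intro: exI[of _ 0])

theorem card_conj_class_involution_prime_power:
  assumes t: "t \<in> carrier G" "t \<noteq> \<one>" "t \<otimes> t = \<one>"
    and p: "prime p" and card: "card (conj_class t) = p ^ c"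
  shows "c = 0"
proof (rule ccontr)
  assume "c \<noteq> 0"
  let ?q = "card (conj_class t)"
  obtain m where m: "kernel_spectrum (carrier G) (reduced_class_kernel t) m"
    using ex_kernel_spectrum[OF finite_carrier] by blast
  have "\<exists>a. of_nat (m l) * l = of_nat ?q * of_int (int p * a)" if "m l \<noteq> 0" for l
    using prime_dvd_class_multiplicity[OF t(1,3) p card _ m that] \<open>c \<noteq> 0\<close> by simp
  then obtain a where a: "\<And>l. m l \<noteq> 0 \<Longrightarrow> of_nat (m l) * l = of_nat ?q * of_int (int p * a l)"
    by metis
  define s where "s = (\<Sum>l | m l \<noteq> 0. a l)"
  have "reduced_class_kernel t \<one> \<one> = - of_nat ?q / of_nat (order G)"
    using one_mem_conj_class_iff[OF t(1)] t(2) by (simp add: reduced_class_kernel_def class_kernel_def)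
  then have "- of_nat ?q = of_nat (order G) * reduced_class_pow t (Suc 0) \<one> \<one>"
    using finite_carrier order_gt_0_iff_finite by (simp add: kernel_pow_one)
  also have "\<dots> = (\<Sum>l | m l \<noteq> 0. of_nat (m l) * l ^ Suc 0)"
    using m kernel_trace_reduced_class_pow[OF finite_carrier t(1), of "Suc 0"]
    unfolding kernel_spectrum_def by metis
  also have "\<dots> = (\<Sum>l | m l \<noteq> 0. of_nat ?q * of_int (int p * a l))"
    using a by (intro sum.cong) auto
  also have "\<dots> = of_nat ?q * of_int (int p * s)"
    by (simp add: s_def sum_distrib_left)
  finally have "of_nat ?q * of_int (int p * s) = (- of_nat ?q :: complex)" by (rule sym)
  then have "of_nat ?q * (of_int (int p * s + 1) :: complex) = 0"
    by (simp add: distrib_left)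
  then have "int p * s + 1 = 0"
    using card_conj_class_pos[OF finite_carrier t(1)] by (simp only: mult_eq_0_iff of_nat_eq_0_iff of_int_eq_0_iff) auto
  then have "int p dvd 1"
    by (metis add_eq_0_iff dvd_minus_iff dvd_triv_left)
  then show False using p by auto
qed

end

section \<open>Burnside's theorem for orders with prime factors 2 and \<open>p\<close>\<close>

lemma prime_power_if_prime_factors_subset_singleton:
  fixes n p :: nat
  assumes "n > 0" "prime_factors n \<subseteq> {p}"
  obtains k where "n = p ^ k"
proof -
  have "n = (\<Prod>q\<in>prime_factors n. q ^ multiplicity q n)"
    using assms(1) by (rule prime_factorization_nat)
  moreover have "prime_factors n = {} \<or> prime_factors n = {p}" using assms(2) by auto
  ultimately have "n = p ^ 0 \<or> n = p ^ multiplicity p n" by auto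
  then show ?thesis using that by blast
qed

context simple_group
begin

lemma mem_center_if_odd_conj_class:
  assumes factors: "prime_factors (order G) \<subseteq> {2, p}"
    and t: "t \<in> carrier G" "t \<noteq> \<one>" "t \<otimes> t = \<one>" and odd: "odd (card (conj_class t))"
  shows "t \<in> center G"
proof -
  have pos: "card (conj_class t) > 0"
    using card_conj_class_pos[OF finite_carrier t(1)] .
  have "card (conj_class t) dvd order G" using card_conj_class[OF t(1)] by (metis dvd_triv_left)
  then have "prime_factors (card (conj_class t)) \<subseteq> {2, p}"
    using factors dvd_prime_factors[of "order G" "card (conj_class t)"] order_gt_one by simp
  moreover have "2 \<notin> prime_factors (card (conj_class t))" using odd by (auto simp: in_prime_factors_iff)
  ultimately have factors_class: "prime_factors (card (conj_class t)) \<subseteq> {p}" by blast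
  have "card (conj_class t) = 1"
  proof (rule ccontr)
    assume nontrivial: "card (conj_class t) \<noteq> 1"
    then obtain q where "prime q" "q dvd card (conj_class t)" using prime_factor_nat by blast
    then have "prime p" using factors_class pos by (auto simp: prime_factors_dvd)
    moreover obtain c where c: "card (conj_class t) = p ^ c"
      using prime_power_if_prime_factors_subset_singleton[OF pos factors_class] .
    ultimately have "c = 0"
      using card_conj_class_involution_prime_power[OF t] by blast
    then show False using c nontrivial by simp
  qed
  then have "conj_class t = {t}"
    using self_in_conj_class[OF t(1)] by (auto simp: card_1_singleton_iff)
  then show ?thesis using t(1) by (auto simp: center_conj_iff conj_class_def)
qed

lemma center_nontrivial_if_prime_factors:
  assumes factors: "prime_factors (order G) \<subseteq> {2, p}"
  shows "center G \<noteq> {\<one>}"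
proof (cases "even (order G)")
  case True
  obtain t where t: "t \<in> carrier G" "ord t = 2" "odd (card (conj_class t))"
    using exists_ord_prime_card_conj_class_coprime[OF finite_carrier two_is_prime_nat] True by blast
  then have "t \<noteq> \<one>" "t \<otimes> t = \<one>"
    using pow_ord_eq_1[OF t(1)] by (auto simp: numeral_2_eq_2)
  then show ?thesis using mem_center_if_odd_conj_class[OF factors t(1) _ _ t(3)] by blast
next
  case False
  then have factors_order: "prime_factors (order G) \<subseteq> {p}" using factors by (auto simp: in_prime_factors_iff)
  then obtain k where k: "order G = p ^ k"
    using prime_power_if_prime_factors_subset_singleton[of "order G" p] order_gt_one by auto
  obtain q where "prime q" "q dvd order G" using prime_factor_nat[of "order G"] order_gt_one by auto
  then have "prime p" using factors_order order_gt_one by (auto simp: prime_factors_dvd)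
  moreover have "k > 0" using k order_gt_one by (cases k) auto
  ultimately have "p dvd card (center G)" using p_group_dvd_card_center k by blast
  then show ?thesis using \<open>prime p\<close> by auto
qed

lemma comm_group_if_prime_factors:
  assumes "prime_factors (order G) \<subseteq> {2, p}"
  shows "comm_group G"
proof (rule group_comm_groupI)
  have "center G = carrier G"
    using no_real_normal_subgroup[OF center_normal] center_nontrivial_if_prime_factors[OF assms] by blast
  then show "x \<otimes> y = y \<otimes> x" if "x \<in> carrier G" "y \<in> carrier G" for x y
    using that by (auto simp: center_def)
qed

end

lemma (in normal) simple_group_Mod_if_maximal:
  assumes fin: "finite (carrier G)" and proper: "H \<noteq> carrier G"
    and maximal: "\<And>N. N \<lhd> G \<Longrightarrow> H \<subseteq> N \<Longrightarrow> N = H \<or> N = carrier G"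
  shows "simple_group (G Mod H)"
proof (rule simple_group.intro[OF factorgroup_is_group], unfold_locales)
  have "order (G Mod H) * card H = order G"
    using lagrange[OF subgroup_axioms] by (simp add: FactGroup_def order_def)
  moreover have "order G > 0" using fin order_gt_0_iff_finite by blast
  moreover have "card H \<noteq> order G"
    using proper card_subset_eq[OF fin subset] by (auto simp: order_def)
  ultimately show "order (G Mod H) > 1"
    by (metis Suc_lessI gr0I mult_0 nat_mult_1 One_nat_def)
next
  fix A assume A: "A \<lhd> G Mod H"
  then have sub: "subgroup A (G Mod H)" by (rule normal_imp_subgroup)
  have union: "\<Union>A = {x \<in> carrier G. H #> x \<in> A}"
    by (rule factgroup_subgroup_union_char[OF sub])
  have "H \<in> A" using subgroup.one_closed[OF sub] by simp
  then consider "\<Union>A = carrier G" | "\<Union>A = H"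
    using maximal[OF factgroup_subgroup_union_normal[OF A]] by blast
  then show "A = carrier (G Mod H) \<or> A = {\<one>\<^bsub>G Mod H\<^esub>}"
  proof cases
    case 1
    then have "A = carrier (G Mod H)"
      using subgroup.subset[OF sub] union by (auto simp: carrier_FactGroup)
    then show ?thesis ..
  next
    case 2
    have "a = H" if a: "a \<in> A" for a
    proof -
      obtain x where x: "x \<in> carrier G" "a = H #> x"
        using subgroup.mem_carrier[OF sub a] by (auto simp: carrier_FactGroup)
      then have "x \<in> H" using a union 2 by blast
      then show ?thesis using x coset_join2 subgroup_axioms by blast
    qed
    then have "A = {H}" using \<open>H \<in> A\<close> by blast
    then show ?thesis by simp
  qed
qed

context group
begin

lemma exists_simple_quotient:
  assumes fin: "finite (carrier G)" and nontrivial: "carrier G \<noteq> {\<one>}"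
  obtains M where "M \<lhd> G" "M \<noteq> carrier G" "simple_group (G Mod M)"
proof -
  define \<N> where "\<N> = {M. M \<lhd> G \<and> M \<noteq> carrier G}"
  have "\<N> \<subseteq> Pow (carrier G)"
    by (auto simp: \<N>_def dest: normal_imp_subgroup subgroup.subset)
  then have "finite \<N>" using fin finite_subset by blast
  moreover have "{\<one>} \<in> \<N>" using one_is_normal nontrivial by (auto simp: \<N>_def)
  ultimately obtain M where M: "M \<in> \<N>" and maximal: "\<And>N. N \<in> \<N> \<Longrightarrow> M \<subseteq> N \<Longrightarrow> N = M"
    using finite_has_maximal[of \<N>] by (metis empty_iff)
  then have "simple_group (G Mod M)"
    by (intro normal.simple_group_Mod_if_maximal fin) (auto simp: \<N>_def)
  then show ?thesis using that M by (auto simp: \<N>_def)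
qed

lemma derived_proper_if_prime_factors:
  assumes fin: "finite (carrier G)" and nontrivial: "carrier G \<noteq> {\<one>}"
    and factors: "prime_factors (order G) \<subseteq> {2, p}"
  shows "derived G (carrier G) \<subset> carrier G"
proof -
  obtain M where M: "M \<lhd> G" "M \<noteq> carrier G" "simple_group (G Mod M)"
    using exists_simple_quotient[OF fin nontrivial] .
  have "order (G Mod M) * card M = order G"
    using lagrange[OF normal_imp_subgroup[OF M(1)]] by (simp add: FactGroup_def order_def)
  then have "order (G Mod M) dvd order G" by (metis dvd_triv_left)
  then have "prime_factors (order (G Mod M)) \<subseteq> {2, p}"
    using dvd_prime_factors[of "order G" "order (G Mod M)"] factors fin order_gt_0_iff_finite by simp
  then have "comm_group (G Mod M)"
    by (rule simple_group.comm_group_if_prime_factors[OF M(3)])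
  then have "derived G (carrier G) \<subseteq> M" by (rule derived_minimal[OF M(1)])
  then show ?thesis using subgroup.subset[OF normal_imp_subgroup[OF M(1)]] M(2) by blast
qed

lemma solvable_seq_if_prime_factors:
  assumes "subgroup H G" "finite H" "prime_factors (card H) \<subseteq> {2, p}"
  shows "solvable_seq G H"
  using assms
proof (induction "card H" arbitrary: H rule: less_induct)
  case less
  show ?case
  proof (cases "H = {\<one>}")
    case True
    then show ?thesis using solvable_seq.unity[of G] by simp
  next
    case False
    have proper: "derived G H \<subset> H"
      using group.derived_proper_if_prime_factors[OF subgroup_imp_group[OF less.prems(1)], of p]
        derived_consistent[OF _ less.prems(1), of H] less.prems False by (simp add: order_def)
    have sub: "subgroup (derived G H) G"
      using derived_is_subgroup subgroup.subset[OF less.prems(1)] by blast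
    have "card (derived G H) dvd card H"
      using card_subgroup_dvd[OF sub less.prems(1)] proper by blast
    moreover have "card H > 0"
      using less.prems(2) subgroup.one_closed[OF less.prems(1)] by (auto simp: card_gt_0_iff)
    ultimately have "prime_factors (card (derived G H)) \<subseteq> {2, p}"
      using dvd_prime_factors[of "card H" "card (derived G H)"] less.prems(3) by simp
    moreover have "card (derived G H) < card H"
      using psubset_card_mono[OF less.prems(2) proper] .
    moreover have "finite (derived G H)"
      using less.prems(2) proper by (meson finite_subset psubset_imp_subset)
    ultimately have "solvable_seq G (derived G H)" using less.hyps sub by simp
    then show ?thesis using augment_solvable_seq[OF less.prems(1)] by blast
  qed
qed

theorem solvable_if_prime_factors:
  assumes "finite (carrier G)" "prime_factors (order G) \<subseteq> {2, p}"
  shows "solvable G"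
  using solvable_seq_if_prime_factors[OF subgroup_self] assms by (simp add: solvable_def order_def)

lemma solvable_exists_abelian_normal:
  assumes solvable: "solvable G" and nontrivial: "carrier G \<noteq> {\<one>}"
  obtains A where "A \<lhd> G" "A \<noteq> {\<one>}" "\<And>x y. x \<in> A \<Longrightarrow> y \<in> A \<Longrightarrow> x \<otimes> y = y \<otimes> x"
proof -
  let ?D = "\<lambda>n. (derived G ^^ n) (carrier G)"
  define n where "n = (LEAST n. ?D n = {\<one>})"
  have n: "?D n = {\<one>}"
    using solvable unfolding solvable_iff_trivial_derived_seq n_def by (rule LeastI_ex)
  then obtain m where m: "n = Suc m" using nontrivial by (cases n) auto
  have normal: "?D k \<lhd> G" for k
    by (induction k) (auto intro: normal_self derived_is_normal)
  have "?D m \<noteq> {\<one>}" using not_less_Least[of m "\<lambda>n. ?D n = {\<one>}"] m by (simp add: n_def)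
  moreover have "x \<otimes> y = y \<otimes> x" if "x \<in> ?D m" "y \<in> ?D m" for x y
  proof -
    have carrier: "x \<in> carrier G" "y \<in> carrier G"
      using that subgroup.mem_carrier[OF normal_imp_subgroup[OF normal[of m]]] by blast+
    have "x \<otimes> y \<otimes> inv x \<otimes> inv y \<in> derived G (?D m)"
      unfolding derived_def[of G "?D m"] using that by (intro generate.incl) auto
    then have "x \<otimes> y \<otimes> inv x \<otimes> inv y = \<one>" using n m by simp
    then show ?thesis using carrier by (metis inv_solve_right' l_one m_closed inv_closed)
  qed
  ultimately show ?thesis using that normal by blast
qed

definition elementary_abelian :: "nat \<Rightarrow> 'a set \<Rightarrow> bool" where
  "elementary_abelian p A \<longleftrightarrow> subgroup A G \<and> (\<forall>x\<in>A. \<forall>y\<in>A. x \<otimes> y = y \<otimes> x) \<and> (\<forall>x\<in>A. x [^] p = \<one>)"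

lemma elementary_abelian_imp_subgroup: "elementary_abelian p A \<Longrightarrow> subgroup A G"
  by (simp add: elementary_abelian_def)

lemma elementary_abelian_ord:
  assumes "elementary_abelian p A" "prime p" "x \<in> A" "x \<noteq> \<one>"
  shows "ord x = p"
  using assms ord_eq_prime subgroup.mem_carrier unfolding elementary_abelian_def by metis

lemma elementary_abelian_card:
  assumes A: "elementary_abelian p A" "finite A" and p: "prime p"
  obtains k where "card A = p ^ k"
proof -
  note sub = elementary_abelian_imp_subgroup[OF A(1)]
  have "q = p" if q: "q \<in> prime_factors (card A)" for q
  proof -
    have q_prime: "prime q" "q dvd card A" using q by auto
    then obtain x where x: "x \<in> A" "ord x = q" using subgroup_exists_ord_prime[OF sub A(2)] by blast
    then have "x \<noteq> \<one>" using q_prime(1) by auto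
    then show ?thesis using elementary_abelian_ord[OF A(1) p x(1)] x(2) by simp
  qed
  then have "prime_factors (card A) \<subseteq> {p}" by blast
  moreover have "card A > 0" using A(2) subgroup.one_closed[OF sub] by (auto simp: card_gt_0_iff)
  ultimately show ?thesis using prime_power_if_prime_factors_subset_singleton that by blast
qed

lemma conj_nat_pow:
  assumes "g \<in> carrier G" "x \<in> carrier G"
  shows "(g \<otimes> x \<otimes> inv g) [^] (n::nat) = g \<otimes> x [^] n \<otimes> inv g"
  using assms by (induction n) (simp_all add: m_assoc)

lemma elementary_abelian_torsion:
  assumes A: "A \<lhd> G" and comm: "\<And>x y. x \<in> A \<Longrightarrow> y \<in> A \<Longrightarrow> x \<otimes> y = y \<otimes> x"
  shows "{x \<in> A. x [^] (p::nat) = \<one>} \<lhd> G" "elementary_abelian p {x \<in> A. x [^] p = \<one>}"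
proof -
  note sub = normal_imp_subgroup[OF A]
  have AG: "x \<in> carrier G" if "x \<in> A" for x using subgroup.mem_carrier[OF sub that] .
  have subgroup: "subgroup {x \<in> A. x [^] p = \<one>} G"
  proof (rule subgroupI)
    fix x y assume "x \<in> {x \<in> A. x [^] p = \<one>}" "y \<in> {x \<in> A. x [^] p = \<one>}"
    then show "x \<otimes> y \<in> {x \<in> A. x [^] p = \<one>}"
      using subgroup.m_closed[OF sub] pow_mult_distrib[OF comm, of x y p] AG by auto
  qed (use subgroup.one_closed[OF sub] subgroup.m_inv_closed[OF sub] AG in \<open>auto simp: nat_pow_inv\<close>)
  then show "{x \<in> A. x [^] p = \<one>} \<lhd> G"
    by (rule normal_invI) (use normal.inv_op_closed2[OF A] conj_nat_pow AG in auto)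
  show "elementary_abelian p {x \<in> A. x [^] p = \<one>}"
    using subgroup comm by (auto simp: elementary_abelian_def)
qed

lemma solvable_exists_elementary_abelian_normal:
  assumes solvable: "solvable G" and fin: "finite (carrier G)" and nontrivial: "carrier G \<noteq> {\<one>}"
  obtains p Z where "p \<in> prime_factors (order G)" "Z \<lhd> G" "Z \<noteq> {\<one>}" "elementary_abelian p Z"
proof -
  obtain A where A: "A \<lhd> G" "A \<noteq> {\<one>}" "\<And>x y. x \<in> A \<Longrightarrow> y \<in> A \<Longrightarrow> x \<otimes> y = y \<otimes> x"
    using solvable_exists_abelian_normal[OF solvable nontrivial] by blast
  note sub = normal_imp_subgroup[OF A(1)]
  have finA: "finite A" using fin subgroup.subset[OF sub] finite_subset by blast
  have "card A \<noteq> 1" using A(2) subgroup.one_closed[OF sub] by (auto simp: card_1_singleton_iff)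
  then obtain p where p: "prime p" "p dvd card A" using prime_factor_nat by blast
  have "card A dvd order G"
    using card_subgroup_dvd[OF sub subgroup_self] subgroup.subset[OF sub] by (simp add: order_def)
  then have "p \<in> prime_factors (order G)"
    using p fin order_gt_0_iff_finite by (auto simp: in_prime_factors_iff dest: dvd_trans)
  moreover obtain x where x: "x \<in> A" "ord x = p" using subgroup_exists_ord_prime[OF sub finA p] .
  then have "x \<noteq> \<one>" "x [^] p = \<one>"
    using p(1) subgroup.mem_carrier[OF sub x(1)] pow_ord_eq_1[of x] by auto
  then have "{x \<in> A. x [^] p = \<one>} \<noteq> {\<one>}" using x(1) by blast
  ultimately show ?thesis using that elementary_abelian_torsion[OF A(1,3)] by blast
qed

end

section \<open>Permutation groups\<close>

lemma funpow_fixed_coprime: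
  fixes i j :: nat
  assumes "(f ^^ i) x = x" "(f ^^ j) x = x" "coprime i j" "i \<noteq> 0"
  shows "f x = x"
proof -
  obtain a b where ab: "i * a = j * b + 1"
    using bezout_nat[OF assms(4), of j] assms(3) by auto
  have "(f ^^ (i * a)) x = x" using funpow_mod_eq[OF assms(1), of "i * a"] by simp
  moreover have "(f ^^ (j * b)) x = x" using funpow_mod_eq[OF assms(2), of "j * b"] by simp
  ultimately show ?thesis using ab by simp
qed

text \<open>The orbit of a point that is not fixed has \<open>p\<close> elements.\<close>

lemma funpow_prime_fixes_small_set:
  assumes p: "prime p" and pow: "(f ^^ p) x = x"
    and S: "finite S" "card S < p" "f ` S \<subseteq> S" and x: "x \<in> S"
  shows "f x = x"
proof -
  have mem: "(f ^^ i) x \<in> S" for i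
    using x S(3) by (induction i) auto
  have "\<not> inj_on (\<lambda>i. (f ^^ i) x) {..<p}"
    using card_inj_on_le[of "\<lambda>i. (f ^^ i) x" "{..<p}" S] mem S(1,2) by auto
  then obtain i j where ij: "i < j" "j < p" "(f ^^ i) x = (f ^^ j) x"
    unfolding inj_on_def by (metis lessThan_iff linorder_neqE_nat)
  have full_turn: "(f ^^ (p - i)) ((f ^^ i) x) = x"
    using pow ij(1,2) by (simp flip: funpow_add[THEN fun_cong, unfolded comp_def])
  have period: "(f ^^ (j - i)) ((f ^^ i) x) = (f ^^ i) x"
    using ij(1) ij(3)[symmetric] by (simp flip: funpow_add[THEN fun_cong, unfolded comp_def])
  have "(f ^^ (j - i)) x = (f ^^ (j - i)) ((f ^^ (p - i)) ((f ^^ i) x))"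
    by (simp only: full_turn)
  also have "\<dots> = (f ^^ (p - i)) ((f ^^ (j - i)) ((f ^^ i) x))"
    by (simp add: ac_simps flip: funpow_add[THEN fun_cong, unfolded comp_def])
  also have "\<dots> = x" by (simp only: period full_turn)
  finally have "(f ^^ (j - i)) x = x" .
  moreover have "\<not> p dvd j - i" using ij(1,2) by (auto dest: dvd_imp_le)
  then have "coprime (j - i) p" using prime_imp_coprime[OF p] coprime_commute by blast
  ultimately show ?thesis
    using funpow_fixed_coprime[OF _ pow] ij(1) by simp
qed

lemma permutation_of_three_fixing_point_involution:
  assumes "card S = 3" "inj_on f S" "f ` S \<subseteq> S" "y \<in> S" "f y = y" "x \<in> S"
  shows "f (f x) = x"
proof -
  obtain a b where S: "S - {y} = {a, b}" "a \<noteq> b"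
    using assms(1,4) card_2_iff[of "S - {y}"] by auto
  have mem: "f z \<in> {a, b}" if "z \<in> {a, b}" for z
  proof -
    have z: "z \<in> S" "z \<noteq> y" using that S(1) by auto
    then have "f z \<noteq> y" using assms(2,4,5) by (metis inj_onD)
    then show ?thesis using z(1) assms(3) unfolding S(1)[symmetric] by blast
  qed
  have "f a \<noteq> f b" using S assms(2) by (metis DiffE inj_onD insertCI)
  then have "f a = a \<and> f b = b \<or> f a = b \<and> f b = a" using mem[of a] mem[of b] by auto
  moreover have "x = y \<or> x = a \<or> x = b" using assms(6) S(1) by blast
  ultimately show ?thesis using assms(5) by (elim disjE conjE) simp_all
qed

lemma involution_of_three_fixes_point:
  assumes "card S = 3" "f ` S \<subseteq> S" "\<And>x. x \<in> S \<Longrightarrow> f (f x) = x"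
  shows "\<exists>x\<in>S. f x = x"
  using assms by (auto simp: card_3_iff) metis

text \<open>The parameter \<open>\<G>\<close> only names the group structure, which makes its notation available.\<close>

locale finite_perm_group =
  fixes V :: "'a set" and G :: "('a \<Rightarrow> 'a) set" and \<G> (structure)
  assumes finite_V: "finite V" and subgroup_BijGroup: "subgroup G (BijGroup V)"
    and perm_group_def: "\<G> = BijGroup V\<lparr>carrier := G\<rparr>"
begin

lemma carrier_eq [simp]: "carrier \<G> = G"
  by (simp add: perm_group_def)

sublocale group \<G>
  unfolding perm_group_def using group.subgroup_imp_group[OF group_BijGroup subgroup_BijGroup] .

lemma mem_Bij: "g \<in> G \<Longrightarrow> g \<in> Bij V"
  using subgroup.mem_carrier[OF subgroup_BijGroup] by (simp add: BijGroup_def)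

lemma mem_bij_betw: "g \<in> G \<Longrightarrow> bij_betw g V V"
  using mem_Bij by (simp add: Bij_def)

lemma apply_mem [simp]: "g \<in> G \<Longrightarrow> v \<in> V \<Longrightarrow> g v \<in> V"
  using mem_bij_betw by (auto simp: bij_betw_def)

lemma apply_eq_iff: "g \<in> G \<Longrightarrow> u \<in> V \<Longrightarrow> v \<in> V \<Longrightarrow> g u = g v \<longleftrightarrow> u = v"
  using mem_bij_betw by (auto simp: bij_betw_def dest: inj_onD)

lemma perm_eqI: "g \<in> G \<Longrightarrow> h \<in> G \<Longrightarrow> (\<And>v. v \<in> V \<Longrightarrow> g v = h v) \<Longrightarrow> g = h"
  using mem_Bij by (auto simp: Bij_def intro: extensionalityI)

lemma finite_G: "finite G"
proof -
  have "G \<subseteq> V \<rightarrow>\<^sub>E V" using mem_Bij by (auto simp: Bij_def PiE_def)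
  then show ?thesis using finite_PiE[OF finite_V] finite_V by (meson finite_subset)
qed

lemma closed_G [simp]:
  "\<one> \<in> G" "g \<in> G \<Longrightarrow> h \<in> G \<Longrightarrow> g \<otimes> h \<in> G" "g \<in> G \<Longrightarrow> inv g \<in> G" "g \<in> G \<Longrightarrow> g [^] (n::nat) \<in> G"
  using one_closed m_closed inv_closed nat_pow_closed by auto

lemma one_apply [simp]: "v \<in> V \<Longrightarrow> \<one> v = v"
  by (simp add: perm_group_def BijGroup_def)

lemma mult_apply [simp]: "g \<in> G \<Longrightarrow> h \<in> G \<Longrightarrow> v \<in> V \<Longrightarrow> (g \<otimes> h) v = g (h v)"
  using mem_Bij by (simp add: perm_group_def BijGroup_def compose_eq)

lemma inv_apply [simp]:
  assumes "g \<in> G" "v \<in> V"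
  shows "(inv g) (g v) = v" "g ((inv g) v) = v"
  using mult_apply[of "inv g" g v] mult_apply[of g "inv g" v] assms by auto

lemma inv_apply_fixed: "g \<in> G \<Longrightarrow> v \<in> V \<Longrightarrow> g v = v \<Longrightarrow> (inv g) v = v"
  using inv_apply(1)[of g v] by simp

lemma pow_apply:
  assumes "g \<in> G" "v \<in> V"
  shows "(g [^] (n::nat)) v = (g ^^ n) v"
  using assms(2)
proof (induction n arbitrary: v)
  case (Suc n)
  then show ?case using assms(1) by (simp add: funpow_swap1)
qed simp

lemma subgroup_mem_G: "subgroup N \<G> \<Longrightarrow> n \<in> N \<Longrightarrow> n \<in> G"
  using subgroup.mem_carrier by fastforce

lemma finite_subgroup: "subgroup N \<G> \<Longrightarrow> finite N"
  using subgroup_mem_G finite_G by (meson finite_subset subsetI)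

lemma elementary_abelian_mem_G: "elementary_abelian p Z \<Longrightarrow> z \<in> Z \<Longrightarrow> z \<in> G"
  by (rule subgroup_mem_G[OF elementary_abelian_imp_subgroup])

lemma elementary_abelian_apply_commute:
  assumes Z: "elementary_abelian p Z" and "y \<in> Z" "z \<in> Z" "v \<in> V"
  shows "y (z v) = z (y v)"
  using assms mult_apply elementary_abelian_mem_G[OF Z] unfolding elementary_abelian_def by metis

lemma point_stabilizer_subgroup:
  assumes N: "subgroup N \<G>" and v: "v \<in> V"
  shows "subgroup {n \<in> N. n v = v} \<G>"
proof (rule subgroupI)
  have NG: "N \<subseteq> G" using subgroup.subset[OF N] by simp
  then show "{n \<in> N. n v = v} \<subseteq> carrier \<G>" by auto
  show "{n \<in> N. n v = v} \<noteq> {}" using v subgroup.one_closed[OF N] by auto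
  show "inv n \<in> {n \<in> N. n v = v}" if "n \<in> {n \<in> N. n v = v}" for n
    using that NG v subgroup.m_inv_closed[OF N] inv_apply_fixed by auto
  show "m \<otimes> n \<in> {n \<in> N. n v = v}" if "m \<in> {n \<in> N. n v = v}" "n \<in> {n \<in> N. n v = v}" for m n
    using that NG v subgroup.m_closed[OF N] by (auto simp: subset_iff)
qed

lemma conj_apply:
  assumes "g \<in> G" "a \<in> G" "v \<in> V"
  shows "(g \<otimes> a \<otimes> inv g) (g v) = g (a v)"
  using assms by simp

lemma normal_fixing_transport:
  assumes N: "N \<lhd> \<G>" and g: "g \<in> G" and a: "a \<in> N" "a \<noteq> \<one>" and v: "v \<in> V" "a v = v"
  shows "\<exists>b\<in>N. b \<noteq> \<one> \<and> b (g v) = g v"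
proof (intro bexI conjI)
  have aG: "a \<in> G" using subgroup_mem_G[OF normal_imp_subgroup[OF N] a(1)] .
  show "g \<otimes> a \<otimes> inv g \<in> N" using normal.inv_op_closed2[OF N _ a(1)] g by simp
  show "(g \<otimes> a \<otimes> inv g) (g v) = g v" using conj_apply[OF g aG v(1)] v(2) by simp
  show "g \<otimes> a \<otimes> inv g \<noteq> \<one>"
    using a(2) g aG conjugation_is_inj[of g a \<one>] by auto
qed

lemma semiregular_element_if_prime_ord:
  assumes g: "g \<in> G" "prime (ord g)" and no_fixed: "\<And>v. v \<in> V \<Longrightarrow> g v \<noteq> v"
  shows "semiregular_element V g"
proof -
  have one: "\<one>\<^bsub>BijGroup V\<^esub> = \<one>" by (simp add: perm_group_def)
  have "g [^] k = \<one>" if v: "v \<in> V" "(g [^] k) v = v" for k :: int and v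
  proof (rule ccontr)
    assume "g [^] k \<noteq> \<one>"
    then have not_dvd: "\<not> int (ord g) dvd k" using g(1) int_pow_eq_id by simp
    define n where "n = nat (k mod int (ord g))"
    have n: "int n = k mod int (ord g)" using g(2) by (simp add: n_def prime_gt_0_nat)
    have "g [^] k = g [^] int n"
      using g(1) int_pow_eq[of g k "int n"] by (simp add: n flip: mod_eq_dvd_iff)
    then have "g [^] k = g [^] n" by (simp only: int_pow_int)
    then have "(g ^^ n) v = v" using v pow_apply[OF g(1)] by metis
    moreover have "(g ^^ ord g) v = v"
      using pow_apply[OF g(1) v(1), of "ord g"] pow_ord_eq_1[of g] g(1) v(1) by simp
    moreover have "coprime n (ord g)"
    proof -
      have "\<not> ord g dvd n" using not_dvd n by (metis dvd_mod_iff dvd_refl int_dvd_int_iff)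
      then show ?thesis using prime_imp_coprime[OF g(2)] by (simp add: coprime_commute)
    qed
    moreover have "n \<noteq> 0" using n not_dvd by (metis dvd_eq_mod_eq_0 int_ops(1))
    ultimately show False using funpow_fixed_coprime no_fixed[OF v(1)] by metis
  qed
  moreover have "g \<noteq> \<one>" using g(2) by auto
  moreover have "g [^]\<^bsub>BijGroup V\<^esub> k = g [^] k" for k :: int
    using group.int_pow_consistent[OF group_BijGroup subgroup_BijGroup g(1)] by (simp add: perm_group_def)
  ultimately show ?thesis unfolding semiregular_element_def one by simp
qed

lemma semiregular_element_if_three_cycles:
  assumes g: "g \<in> G" and V: "V \<noteq> {}"
    and cycle: "\<And>v. v \<in> V \<Longrightarrow> g (g (g v)) = v" "\<And>v. v \<in> V \<Longrightarrow> g v \<noteq> v"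
  shows "semiregular_element V g"
proof (rule semiregular_element_if_prime_ord[OF g _ cycle(2)])
  have "g [^] (3::nat) = \<one>"
    using g cycle(1) by (intro perm_eqI) (auto simp: pow_apply numeral_3_eq_3)
  moreover have "g \<noteq> \<one>" using V cycle(2) by force
  ultimately have "ord g = 3" using g by (intro ord_eq_prime) auto
  then show "prime (ord g)" by simp
qed

lemma card_Collect_apply:
  assumes g: "g \<in> G"
  shows "card {v \<in> V. P (g v)} = card {v \<in> V. P v}"
proof (rule bij_betw_same_card)
  show "bij_betw g {v \<in> V. P (g v)} {v \<in> V. P v}"
    using mem_bij_betw[OF g] by (auto simp: bij_betw_def inj_on_def)
qed

definition orbital :: "'a \<Rightarrow> 'a \<Rightarrow> 'a \<Rightarrow> 'a \<Rightarrow> bool" where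
  "orbital v x a b \<longleftrightarrow> (\<exists>g\<in>G. g v = a \<and> g x = b)"

lemma orbital_invariant:
  assumes V: "v \<in> V" "x \<in> V" and g: "g \<in> G" "a \<in> V" "b \<in> V"
  shows "orbital v x (g a) (g b) \<longleftrightarrow> orbital v x a b"
proof
  assume "orbital v x a b"
  then obtain h where "h \<in> G" "h v = a" "h x = b" by (auto simp: orbital_def)
  then show "orbital v x (g a) (g b)" unfolding orbital_def using g V by (intro bexI[of _ "g \<otimes> h"]) auto
next
  assume "orbital v x (g a) (g b)"
  then obtain h where "h \<in> G" "h v = g a" "h x = g b" by (auto simp: orbital_def)
  then show "orbital v x a b" unfolding orbital_def using g V by (intro bexI[of _ "inv g \<otimes> h"]) auto
qed

lemma orbital_swap:
  assumes V: "v \<in> V" "x \<in> V" and "orbital v x a b" "orbital v x b a"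
  shows "\<exists>r\<in>G. r a = b \<and> r b = a"
proof -
  obtain g h where g: "g \<in> G" "g v = a" "g x = b" and h: "h \<in> G" "h v = b" "h x = a"
    using assms by (auto simp: orbital_def)
  then have "(h \<otimes> inv g) a = b" "(h \<otimes> inv g) b = a"
    using V inv_apply(1)[OF g(1)] by auto
  then show ?thesis using g(1) h(1) by (intro bexI[of _ "h \<otimes> inv g"]) auto
qed

text \<open>Count the related pairs by rows and by columns.\<close>

lemma invariant_relation_degrees_eq:
  assumes invariant: "\<And>g a b. g \<in> G \<Longrightarrow> a \<in> V \<Longrightarrow> b \<in> V \<Longrightarrow> R (g a) (g b) \<longleftrightarrow> R a b"
    and v: "v \<in> V" and transitive: "\<And>u. u \<in> V \<Longrightarrow> \<exists>g\<in>G. g v = u"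
  shows "card {b \<in> V. R v b} = card {b \<in> V. R b v}"
proof -
  have rows: "card {b \<in> V. R u b} = card {b \<in> V. R v b}"
    and columns: "card {b \<in> V. R b u} = card {b \<in> V. R b v}" if u: "u \<in> V" for u
  proof -
    obtain g where g: "g \<in> G" "g v = u" using transitive[OF u] by blast
    have "{b \<in> V. R u (g b)} = {b \<in> V. R v b}" "{b \<in> V. R (g b) u} = {b \<in> V. R b v}"
      using invariant[OF g(1)] v g(2) by blast+
    then show "card {b \<in> V. R u b} = card {b \<in> V. R v b}"
      "card {b \<in> V. R b u} = card {b \<in> V. R b v}"
      using card_Collect_apply[OF g(1), of "R u"] card_Collect_apply[OF g(1), of "\<lambda>b. R b u"] by simp_all
  qed
  have "(\<Sum>a\<in>V. card {b \<in> V. R a b}) = card {b \<in> V. R b v} * card V"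
    using columns by (intro sum_multicount finite_V) auto
  then have "card {b \<in> V. R v b} * card V = card {b \<in> V. R b v} * card V"
    using rows by (simp add: mult.commute)
  moreover have "card V > 0" using finite_V v by (auto simp: card_gt_0_iff)
  ultimately show ?thesis by simp
qed

end

section \<open>Automorphism groups of cubic graphs\<close>

locale graph_aut_group = finite_perm_group V G \<G>
  for V :: "'a set" and G and \<G> (structure) +
  fixes E :: "'a \<Rightarrow> 'a \<Rightarrow> bool"
  assumes simple: "simple_graph V E" and aut: "G \<subseteq> graph_aut V E"
begin

definition neighbours :: "'a \<Rightarrow> 'a set" where
  "neighbours v = {w. E v w}"

lemma neighbours_subset: "neighbours v \<subseteq> V"
  using simple by (auto simp: neighbours_def simple_graph_def)

lemma neighbours_mem_V: "w \<in> neighbours v \<Longrightarrow> v \<in> V" "w \<in> neighbours v \<Longrightarrow> w \<in> V"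
  using simple by (auto simp: neighbours_def simple_graph_def)

lemma neighbours_sym: "w \<in> neighbours v \<longleftrightarrow> v \<in> neighbours w"
  using simple by (auto simp: neighbours_def simple_graph_def)

lemma finite_neighbours: "finite (neighbours v)"
  using neighbours_subset finite_V finite_subset by blast

lemma apply_mem_neighbours_iff:
  "g \<in> G \<Longrightarrow> v \<in> V \<Longrightarrow> w \<in> V \<Longrightarrow> g w \<in> neighbours (g v) \<longleftrightarrow> w \<in> neighbours v"
  using aut by (auto simp: neighbours_def graph_aut_def)

lemma neighbours_apply:
  assumes g: "g \<in> G" and v: "v \<in> V"
  shows "neighbours (g v) = g ` neighbours v"
proof
  show "g ` neighbours v \<subseteq> neighbours (g v)"
    using apply_mem_neighbours_iff[OF g v] neighbours_mem_V by blast
  show "neighbours (g v) \<subseteq> g ` neighbours v"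
  proof
    fix w assume w: "w \<in> neighbours (g v)"
    then have "w = g ((inv g) w)" using g neighbours_mem_V by simp
    moreover have "(inv g) w \<in> neighbours v"
      using w g v neighbours_mem_V(2)[OF w] apply_mem_neighbours_iff[OF g v, of "(inv g) w"] by simp
    ultimately show "w \<in> g ` neighbours v" by blast
  qed
qed

lemma neighbours_fixed: "g \<in> G \<Longrightarrow> v \<in> V \<Longrightarrow> g v = v \<Longrightarrow> g ` neighbours v = neighbours v"
  using neighbours_apply[of g v] by simp

end

locale cubic_graph_aut_group = graph_aut_group V G \<G> E
  for V :: "'a set" and G and \<G> (structure) and E +
  assumes connected: "connected_graph V E" and cubic: "cubic V E"
begin

lemma V_nonempty: "V \<noteq> {}"
  using connected by (simp add: connected_graph_def)

lemma card_neighbours: "v \<in> V \<Longrightarrow> card (neighbours v) = 3"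
  using cubic by (simp add: cubic_def neighbours_def)

lemma neighbours_nonempty: "v \<in> V \<Longrightarrow> neighbours v \<noteq> {}"
  using card_neighbours by fastforce

lemma connected_induct [consumes 2, case_names base step]:
  assumes u: "u \<in> V" and v: "v \<in> V" and base: "P v"
    and step: "\<And>u w. u \<in> V \<Longrightarrow> P u \<Longrightarrow> w \<in> neighbours u \<Longrightarrow> P w"
  shows "P u"
proof -
  have "E\<^sup>*\<^sup>* v u" using connected v u by (simp add: connected_graph_def)
  then have "u \<in> V \<and> P u"
  proof (induction rule: rtranclp_induct)
    case (step y z)
    then have "z \<in> neighbours y" by (simp add: neighbours_def)
    then show ?case using step.IH assms(4) neighbours_mem_V(2) by blast
  qed (use v base in simp)
  then show ?thesis ..
qed

lemma eq_one_if_fixing_propagates: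
  assumes g: "g \<in> G" and v: "v \<in> V" "g v = v"
    and step: "\<And>u w. u \<in> V \<Longrightarrow> g u = u \<Longrightarrow> w \<in> neighbours u \<Longrightarrow> g w = w"
  shows "g = \<one>"
proof (rule perm_eqI)
  fix u assume "u \<in> V"
  then have "g u = u" using v(1)
  proof (induction rule: connected_induct)
    case (step u w)
    then show ?case using assms(4) by blast
  qed (rule v(2))
  then show "g u = \<one> u" using \<open>u \<in> V\<close> by simp
qed (use g in auto)

lemma prime_pow_fixes_small_set:
  assumes g: "g \<in> G" "g [^] p = \<one>" "prime p"
    and S: "S \<subseteq> V" "g ` S \<subseteq> S" "card S < p" and x: "x \<in> S"
  shows "g x = x"
proof (rule funpow_prime_fixes_small_set[OF g(3)])
  show "(g ^^ p) x = x" using pow_apply[OF g(1), of x p] g(2) S(1) x by (metis one_apply subsetD)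
  show "finite S" using S(1) finite_V finite_subset by blast
qed (use S x in auto)

theorem semiregular_if_large_prime_dvd_card:
  assumes p: "prime p" "p dvd card G" "p > 3"
  shows "\<exists>g\<in>G. semiregular_element V g"
proof -
  obtain g where g: "g \<in> G" "ord g = p"
    using subgroup_exists_ord_prime[OF subgroup_self _ p(1)] finite_G p(2) by auto
  have pow: "g [^] p = \<one>" using pow_ord_eq_1[of g] g by simp
  have "g v \<noteq> v" if v: "v \<in> V" for v
  proof
    assume "g v = v"
    then have "g = \<one>"
    proof (rule eq_one_if_fixing_propagates[OF g(1) v])
      fix u w assume u: "u \<in> V" "g u = u" and w: "w \<in> neighbours u"
      show "g w = w"
        using neighbours_fixed[OF g(1) u] card_neighbours[OF u(1)] p(3)
        by (intro prime_pow_fixes_small_set[OF g(1) pow p(1) neighbours_subset _ _ w]) auto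
    qed
    then show False using g(2) p(3) by simp
  qed
  then have "semiregular_element V g"
    using semiregular_element_if_prime_ord g p(1) by simp
  then show ?thesis using g(1) by blast
qed

lemma eq_one_if_pow_three_fixes_arc:
  assumes g: "g \<in> G" "g [^] (3::nat) = \<one>" and v: "v \<in> V" "g v = v"
    and w: "w \<in> neighbours v" "g w = w"
  shows "g = \<one>"
proof (rule perm_eqI)
  fix u assume u: "u \<in> V"
  then have "g u = u \<and> (\<exists>w\<in>neighbours u. g w = w)"
    using v(1)
  proof (induction rule: connected_induct)
    case base
    then show ?case using v w by blast
  next
    case (step u w)
    then obtain y where y: "y \<in> neighbours u" "g y = y" by blast
    have gu: "g u = u" using step.IH by blast
    have "g w = w"
    proof (cases "w = y")
      case False
      let ?S = "neighbours u - {y}"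
      have "card ?S = 2" using y card_neighbours[OF step.hyps(1)] finite_neighbours by simp
      moreover have "g ` ?S \<subseteq> ?S"
      proof
        fix z assume "z \<in> g ` ?S"
        then obtain x where x: "x \<in> neighbours u" "x \<noteq> y" "z = g x" by auto
        have "g x \<noteq> g y" using apply_eq_iff[OF g(1)] x y neighbours_mem_V(2) by blast
        then show "z \<in> ?S" using x y neighbours_fixed[OF g(1) step.hyps(1) gu] by auto
      qed
      ultimately show ?thesis
        using prime_pow_fixes_small_set[OF g, of ?S w] False step.hyps(2) neighbours_subset by auto
    qed (use y in simp)
    then show ?case using gu step.hyps(2) neighbours_sym by blast
  qed
  then show "g u = \<one> u" using u by simp
qed (use g in auto)

lemma neighbours_eq_rotation:
  assumes g: "g \<in> G" "g [^] (3::nat) = \<one>" "g \<noteq> \<one>" and v: "v \<in> V" "g v = v"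
    and w: "w \<in> neighbours v"
  shows "neighbours v = {w, g w, g (g w)}"
proof -
  have moved: "g x \<noteq> x" if "x \<in> neighbours v" for x
    using eq_one_if_pow_three_fixes_arc[OF g(1,2) v that] g(3) by blast
  have mem: "g x \<in> neighbours v" if "x \<in> neighbours v" for x
    using neighbours_fixed[OF g(1) v] that by blast
  have cube: "g (g (g w)) = w"
    using pow_apply[OF g(1) neighbours_mem_V(2)[OF w], of 3] g(2) neighbours_mem_V(2)[OF w]
    by (simp add: numeral_3_eq_3)
  have "w \<noteq> g w" "g w \<noteq> g (g w)" using moved[OF w] moved[OF mem[OF w]] by auto
  moreover have "w \<noteq> g (g w)" using moved[OF mem[OF mem[OF w]]] cube by auto
  ultimately have "card {w, g w, g (g w)} = card (neighbours v)"
    using card_neighbours[OF v(1)] by simp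
  moreover have "{w, g w, g (g w)} \<subseteq> neighbours v" using w mem by blast
  ultimately show ?thesis using card_subset_eq[OF finite_neighbours] by blast
qed

end

section \<open>Cubic edge-transitive graphs\<close>

locale edge_transitive_cubic_graph = cubic_graph_aut_group V G \<G> E
  for V :: "'a set" and G and \<G> (structure) and E +
  assumes edge_transitive: "edge_transitive E G"
begin

lemma edge_transport:
  assumes "w \<in> neighbours v" "y \<in> neighbours x"
  obtains g where "g \<in> G" "g v = x" "g w = y" | g where "g \<in> G" "g v = y" "g w = x"
  using assms edge_transitive unfolding edge_transitive_def neighbours_def
  by (auto simp: doubleton_eq_iff) metis

lemma arc_transitive_if_arc_reversed:
  assumes r: "r \<in> G" "r a = b" "r b = a" and ab: "b \<in> neighbours a"
    and vw: "w \<in> neighbours v" and xy: "y \<in> neighbours x"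
  shows "\<exists>g\<in>G. g v = x \<and> g w = y"
proof -
  have from_ab: "\<exists>g\<in>G. g a = v \<and> g b = w" if "w \<in> neighbours v" for v w
    using ab that
  proof (cases rule: edge_transport)
    case (2 g)
    then show ?thesis
      using r neighbours_mem_V[OF ab] by (intro bexI[of _ "g \<otimes> r"]) auto
  qed blast
  obtain g where g: "g \<in> G" "g a = v" "g b = w" using from_ab[OF vw] by blast
  obtain h where h: "h \<in> G" "h a = x" "h b = y" using from_ab[OF xy] by blast
  have "(h \<otimes> inv g) v = x" "(h \<otimes> inv g) w = y"
    using g h neighbours_mem_V[OF ab] neighbours_mem_V[OF vw] inv_apply(1)[OF g(1)] by auto
  then show ?thesis using g h by (intro bexI[of _ "h \<otimes> inv g"]) auto
qed

text \<open>If a vertex stabiliser is intransitive on neighbours, then no arc is reversed and each of the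
  two orbits on arcs is an orientation of the graph. All vertices are then equivalent, so in- and
  out-degree are constant, hence equal, contradicting the odd valency.\<close>

theorem locally_transitive:
  assumes x: "x \<in> neighbours v" and y: "y \<in> neighbours v"
  shows "\<exists>g\<in>G. g v = v \<and> g x = y"
proof (rule ccontr)
  assume intransitive: "\<not> ?thesis"
  let ?R = "orbital v x"
  note V = neighbours_mem_V[OF x]
  have R_neighbours: "b \<in> neighbours a" if "?R a b" for a b
    using that x V apply_mem_neighbours_iff by (auto simp: orbital_def)
  have R_total: "?R a b \<or> ?R b a" if "b \<in> neighbours a" for a b
    using x that by (cases rule: edge_transport) (auto simp: orbital_def)
  have R_asym: "\<not> ?R b a" if "?R a b" for a b
    using orbital_swap[OF V that] arc_transitive_if_arc_reversed[OF _ _ _ R_neighbours[OF that] x y]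
      intransitive by blast
  obtain r where r: "r \<in> G" "r v = y" "r x = v"
    using x y intransitive by (cases rule: edge_transport) auto
  have transitive: "\<exists>g\<in>G. g v = u" if u: "u \<in> V" for u
  proof -
    obtain w where "w \<in> neighbours u" using neighbours_nonempty[OF u] by blast
    then have "?R u w \<or> ?R w u" by (rule R_total)
    then consider "?R u w" | h where "h \<in> G" "h x = u" by (auto simp: orbital_def)
    then show ?thesis
    proof cases
      case 2
      then have "(h \<otimes> inv r) v = u" using r V inv_apply(1)[OF r(1) V(2)] by auto
      then show ?thesis using 2 r by (intro bexI[of _ "h \<otimes> inv r"]) auto
    qed (auto simp: orbital_def)
  qed
  have "neighbours v = {b \<in> V. ?R v b} \<union> {b \<in> V. ?R b v}"
    using R_total R_neighbours neighbours_sym neighbours_mem_V by blast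
  moreover have "{b \<in> V. ?R v b} \<inter> {b \<in> V. ?R b v} = {}" using R_asym by auto
  ultimately have "card (neighbours v) = card {b \<in> V. ?R v b} + card {b \<in> V. ?R b v}"
    using finite_V by (simp add: card_Un_disjoint)
  also have "card {b \<in> V. ?R b v} = card {b \<in> V. ?R v b}"
    using invariant_relation_degrees_eq[of ?R v] orbital_invariant[OF V] V(1) transitive by simp
  finally show False using card_neighbours[OF V(1)] by presburger
qed

lemma exists_three_cycle_on_neighbours:
  assumes v: "v \<in> V"
  obtains c where "c \<in> G" "c v = v" "\<And>x. x \<in> neighbours v \<Longrightarrow> c x \<noteq> x"
    "\<And>x. x \<in> neighbours v \<Longrightarrow> c (c (c x)) = x"
proof -
  obtain x1 x2 x3 where neighbours_v: "neighbours v = {x1, x2, x3}" and distinct: "x1 \<noteq> x2" "x2 \<noteq> x3" "x1 \<noteq> x3"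
    using card_neighbours[OF v] by (auto simp: card_3_iff)
  have xV: "x1 \<in> V" "x2 \<in> V" "x3 \<in> V" using neighbours_v neighbours_subset[of v] by auto
  obtain g where g: "g \<in> G" "g v = v" "g x1 = x2"
    using locally_transitive[of x1 v x2] neighbours_v by auto
  obtain h where h: "h \<in> G" "h v = v" "h x1 = x3"
    using locally_transitive[of x1 v x3] neighbours_v by auto
  have g_permutes: "g x2 \<in> {x1, x2, x3}" "g x3 \<in> {x1, x2, x3}" "g x1 \<noteq> g x2" "g x1 \<noteq> g x3" "g x2 \<noteq> g x3"
    using neighbours_fixed[OF g(1) v g(2)] neighbours_v apply_eq_iff[OF g(1)] xV distinct by auto
  have h_permutes: "h x2 \<in> {x1, x2, x3}" "h x3 \<in> {x1, x2, x3}" "h x1 \<noteq> h x2" "h x1 \<noteq> h x3" "h x2 \<noteq> h x3"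
    using neighbours_fixed[OF h(1) v h(2)] neighbours_v apply_eq_iff[OF h(1)] xV distinct by auto
  consider "g x2 = x3" "g x3 = x1" | "h x3 = x2" "h x2 = x1"
    | "g x2 = x1" "g x3 = x3" "h x3 = x1" "h x2 = x2"
    using g_permutes h_permutes g(3) h(3) by auto
  then show ?thesis
  proof cases
    case 1
    show ?thesis
      by (rule that[OF g(1,2)]) (use 1 g(3) neighbours_v distinct in auto)
  next
    case 2
    show ?thesis
      by (rule that[OF h(1,2)]) (use 2 h(3) neighbours_v distinct in auto)
  next
    case 3
    have "(g \<otimes> h) u = g (h u)" if "u \<in> V" for u using g(1) h(1) that by simp
    then show ?thesis
      by (intro that[of "g \<otimes> h"]) (use 3 g h neighbours_v distinct xV v in auto)
  qed
qed

text \<open>If \<open>z\<close> moves a neighbour \<open>w\<close> of \<open>u\<close>, conjugate it to \<open>z'\<close> fixing \<open>w\<close>. Since the two commute,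
  \<open>z'\<close> also fixes \<open>z w\<close> and the fixed point of \<open>z\<close>, so it acts trivially on the neighbours of \<open>u\<close>.\<close>

lemma normal_elementary_abelian_two_fixes_neighbours:
  assumes Z: "Z \<lhd> \<G>" "elementary_abelian 2 Z" and z: "z \<in> Z"
    and u: "u \<in> V" "z u = u" and w: "w \<in> neighbours u"
  shows "z w = w"
proof (rule ccontr)
  assume moved: "z w \<noteq> w"
  note zG = elementary_abelian_mem_G[OF Z(2) z]
  have square: "z (z v) = v" if "v \<in> V" for v
    using Z(2) z pow_apply[OF zG that, of 2] that by (simp add: elementary_abelian_def numeral_2_eq_2)
  have image: "z ` neighbours u = neighbours u" using neighbours_fixed[OF zG u] .
  obtain y where y: "y \<in> neighbours u" "z y = y"
    using involution_of_three_fixes_point[OF card_neighbours[OF u(1)], of z] image square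
      neighbours_mem_V(2) by blast
  have V: "w \<in> V" "y \<in> V" using w y neighbours_mem_V(2) by auto
  have neighbours_u: "neighbours u = {w, z w, y}"
  proof (rule card_subset_eq[OF finite_neighbours, symmetric])
    show "{w, z w, y} \<subseteq> neighbours u" using w y(1) image by blast
    have "w \<noteq> y" "z w \<noteq> y" using moved y(2) square[OF V(1)] by auto
    then show "card {w, z w, y} = card (neighbours u)" using card_neighbours[OF u(1)] moved by simp
  qed
  obtain g where g: "g \<in> G" "g u = u" "g y = w" using locally_transitive[OF y(1) w] by blast
  define z' where "z' = g \<otimes> z \<otimes> inv g"
  have z': "z' \<in> Z" using normal.inv_op_closed2[OF Z(1), of g z] g(1) z by (simp add: z'_def)
  have z'_apply: "z' (g v) = g (z v)" if "v \<in> V" for v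
    using conj_apply[OF g(1) zG that] by (simp add: z'_def)
  have z'w: "z' w = w" using z'_apply[OF V(2)] y(2) g(3) by simp
  moreover have "z' (z w) = z w" using elementary_abelian_apply_commute[OF Z(2) z' z V(1)] z'w by simp
  moreover have "z' y = y"
  proof -
    have "z' u = u" using z'_apply[OF u(1)] u(2) g(2) by simp
    then have "z' y \<in> neighbours u"
      using neighbours_fixed[OF elementary_abelian_mem_G[OF Z(2) z'] u(1)] y(1) by blast
    moreover have "z (z' y) = z' y" using elementary_abelian_apply_commute[OF Z(2) z z' V(2)] y(2) by simp
    ultimately show ?thesis using neighbours_u moved square[OF V(1)] by auto
  qed
  moreover have "g w \<in> neighbours u" using neighbours_fixed[OF g(1) u(1) g(2)] w by blast
  ultimately have "z' (g w) = g w" unfolding neighbours_u by auto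
  then have "g (z w) = g w" using z'_apply[OF V(1)] by simp
  then show False using apply_eq_iff[OF g(1)] zG V(1) moved by simp
qed

theorem semiregular_if_normal_elementary_abelian_two:
  assumes Z: "Z \<lhd> \<G>" "Z \<noteq> {\<one>}" "elementary_abelian 2 Z"
  shows "\<exists>g\<in>G. semiregular_element V g"
proof -
  obtain z where z: "z \<in> Z" "z \<noteq> \<one>"
    using Z(2) subgroup.one_closed[OF normal_imp_subgroup[OF Z(1)]] by blast
  note zG = elementary_abelian_mem_G[OF Z(3) z(1)]
  have "z v \<noteq> v" if v: "v \<in> V" for v
    using eq_one_if_fixing_propagates[OF zG v]
      normal_elementary_abelian_two_fixes_neighbours[OF Z(1,3) z(1)] z(2) by blast
  moreover have "ord z = 2" using elementary_abelian_ord[OF Z(3) _ z] by simp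
  ultimately have "semiregular_element V z"
    using semiregular_element_if_prime_ord[OF zG] by simp
  then show ?thesis using zG by blast
qed

text \<open>A 3-cycle on \<open>neighbours v\<close> fixing \<open>v\<close> acts on \<open>neighbours w\<close> trivially or as a transposition, so
  its fourth power will do.\<close>

lemma exists_rotation_fixing_side:
  assumes w: "w \<in> neighbours v" and side: "\<And>u. u \<in> neighbours v \<Longrightarrow> neighbours u = neighbours w"
  obtains c where "c \<in> G" "\<And>x. x \<in> neighbours w \<Longrightarrow> c x = x"
    "\<And>x. x \<in> neighbours v \<Longrightarrow> c x \<in> neighbours v \<and> c x \<noteq> x \<and> c (c (c x)) = x"
proof -
  note V = neighbours_mem_V[OF w]
  obtain d where d: "d \<in> G" "d v = v" "\<And>x. x \<in> neighbours v \<Longrightarrow> d x \<noteq> x"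
      "\<And>x. x \<in> neighbours v \<Longrightarrow> d (d (d x)) = x"
    using exists_three_cycle_on_neighbours[OF V(1)] by blast
  have d_mem: "d x \<in> neighbours v" if "x \<in> neighbours v" for x
    using neighbours_fixed[OF d(1) V(1) d(2)] that by blast
  have c_apply: "(d [^] (4::nat)) x = d (d (d (d x)))" if "x \<in> V" for x
    using pow_apply[OF d(1) that, of 4] by (simp add: numeral_eq_Suc)
  show ?thesis
  proof (rule that[of "d [^] (4::nat)"])
    fix x assume x: "x \<in> neighbours w"
    have "d ` neighbours w = neighbours w"
      using neighbours_apply[OF d(1) V(2)] side[OF d_mem[OF w]] by simp
    moreover have "inj_on d (neighbours w)"
      using mem_bij_betw[OF d(1)] neighbours_subset by (auto simp: bij_betw_def intro: inj_on_subset)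
    ultimately have "d (d x) = x" if "x \<in> neighbours w" for x
      using permutation_of_three_fixing_point_involution[OF card_neighbours[OF V(2)], of d v x] d(2) that
        w neighbours_sym by auto
    then show "(d [^] (4::nat)) x = x" using c_apply[OF neighbours_mem_V(2)[OF x]] x by simp
  next
    fix x assume x: "x \<in> neighbours v"
    have "(d [^] (4::nat)) y = d y" if "y \<in> neighbours v" for y
      using that d(4) c_apply[OF neighbours_mem_V(2)[OF that]] by simp
    then show "(d [^] (4::nat)) x \<in> neighbours v \<and> (d [^] (4::nat)) x \<noteq> x \<and>
        (d [^] (4::nat)) ((d [^] (4::nat)) ((d [^] (4::nat)) x)) = x"
      using x d_mem d(3,4) by simp
  qed (use d(1) in simp)
qed

lemma semiregular_if_complete_bipartite:
  assumes w: "w \<in> neighbours v"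
    and left: "\<And>u. u \<in> neighbours v \<Longrightarrow> neighbours u = neighbours w"
    and right: "\<And>u. u \<in> neighbours w \<Longrightarrow> neighbours u = neighbours v"
  shows "\<exists>g\<in>G. semiregular_element V g"
proof -
  have v: "v \<in> neighbours w" using w neighbours_sym by blast
  have cover: "u \<in> neighbours v \<or> u \<in> neighbours w" if "u \<in> V" for u
    using that neighbours_mem_V(2)[OF v]
  proof (induction rule: connected_induct)
    case (step u y)
    then show ?case using left[of u] right[of u] by blast
  qed (use v in simp)
  obtain c where c: "c \<in> G" "\<And>x. x \<in> neighbours w \<Longrightarrow> c x = x"
      "\<And>x. x \<in> neighbours v \<Longrightarrow> c x \<in> neighbours v \<and> c x \<noteq> x \<and> c (c (c x)) = x"
    using exists_rotation_fixing_side[OF w left] by blast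
  obtain d where d: "d \<in> G" "\<And>x. x \<in> neighbours v \<Longrightarrow> d x = x"
      "\<And>x. x \<in> neighbours w \<Longrightarrow> d x \<in> neighbours w \<and> d x \<noteq> x \<and> d (d (d x)) = x"
    using exists_rotation_fixing_side[OF v right] by blast
  have on_left: "(c \<otimes> d) x = c x" if "x \<in> neighbours v" for x
    using that c(1) d(1,2) neighbours_mem_V(2) by simp
  have on_right: "(c \<otimes> d) x = d x" if "x \<in> neighbours w" for x
    using that c(1,2) d(1,3) neighbours_mem_V(2) by simp
  have "semiregular_element V (c \<otimes> d)"
  proof (rule semiregular_element_if_three_cycles[OF _ V_nonempty])
    fix u assume "u \<in> V"
    then consider "u \<in> neighbours v" | "u \<in> neighbours w" using cover by blast
    then show "(c \<otimes> d) ((c \<otimes> d) ((c \<otimes> d) u)) = u" "(c \<otimes> d) u \<noteq> u"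
      by (cases; use on_left on_right c(3) d(3) in simp)+
  qed (use c(1) d(1) in simp)
  then show ?thesis using c(1) d(1) by (intro bexI[of _ "c \<otimes> d"]) auto
qed

lemma semiregular_if_fixes_neighbours_of_neighbour:
  assumes a: "a \<in> G" "a [^] (3::nat) = \<one>" "a \<noteq> \<one>" and v: "a v = v"
    and w: "w \<in> neighbours v" and fixed: "\<And>x. x \<in> neighbours w \<Longrightarrow> a x = x"
  shows "\<exists>g\<in>G. semiregular_element V g"
proof (rule semiregular_if_complete_bipartite[OF w])
  note V = neighbours_mem_V[OF w]
  have "neighbours (a u) = neighbours w" if "u \<in> V" "neighbours u = neighbours w" for u
    using neighbours_apply[OF a(1) that(1)] that(2) fixed by simp
  then show left: "neighbours u = neighbours w" if "u \<in> neighbours v" for u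
    using that neighbours_eq_rotation[OF a V(1) v w] V(2) a(1) by auto
  show "neighbours x = neighbours v" if x: "x \<in> neighbours w" for x
  proof -
    have "neighbours v \<subseteq> neighbours x" using left x neighbours_sym by blast
    then show ?thesis
      using card_subset_eq[OF finite_neighbours, of "neighbours v" x] card_neighbours V(1)
        neighbours_mem_V(2)[OF x] by simp
  qed
qed

lemma orbits_of_neighbourhood_cover:
  assumes Z: "elementary_abelian 3 Z" and w: "w \<in> V"
    and stabilised: "\<And>x. x \<in> neighbours w \<Longrightarrow> \<exists>b\<in>Z. b \<noteq> \<one> \<and> b x = x"
    and u: "u \<in> V"
  shows "\<exists>z\<in>Z. \<exists>x\<in>insert w (neighbours w). u = z x"
  using u w
proof (induction rule: connected_induct)
  note sub = elementary_abelian_imp_subgroup[OF Z]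
  note ZG = elementary_abelian_mem_G[OF Z]
  {
    case base
    show ?case using subgroup.one_closed[OF sub] w by (intro bexI[of _ \<one>] bexI[of _ w]) auto
  next
    case (step u y)
    then obtain z x where z: "z \<in> Z" "x \<in> insert w (neighbours w)" "u = z x" by blast
    have xV: "x \<in> V" using z(2) w neighbours_mem_V(2) by blast
    obtain y' where y': "y' \<in> neighbours x" "y = z y'"
      using step.hyps(2) neighbours_apply[OF ZG[OF z(1)] xV] z(3) by blast
    show ?case
    proof (cases "x = w")
      case True
      then show ?thesis using y' z(1) by blast
    next
      case False
      then have x: "x \<in> neighbours w" using z(2) by blast
      obtain b where b: "b \<in> Z" "b \<noteq> \<one>" "b x = x" using stabilised[OF x] by blast
      have "neighbours x = {w, b w, b (b w)}"
        using neighbours_eq_rotation[OF ZG[OF b(1)] _ b(2) xV b(3)] Z b(1) x neighbours_sym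
        by (simp add: elementary_abelian_def)
      then consider "y = z w" | "y = (z \<otimes> b) w" | "y = (z \<otimes> (b \<otimes> b)) w"
        using y' z(1) b(1) ZG w by auto
      then show ?thesis using z(1) b(1) subgroup.m_closed[OF sub] by cases blast+
    qed
  }
qed

lemma fixes_neighbour_if_fixed_point:
  assumes Z: "elementary_abelian 3 Z" and w: "w \<in> V"
    and stabilised: "\<And>x. x \<in> neighbours w \<Longrightarrow> \<exists>b\<in>Z. b \<noteq> \<one> \<and> b x = x"
    and z: "z \<in> Z" "z w \<noteq> w" and u: "u \<in> V" "z u = u"
  shows "\<exists>x\<in>neighbours w. z x = x"
proof -
  note ZG = elementary_abelian_mem_G[OF Z]
  have "\<exists>y\<in>Z. \<exists>x\<in>insert w (neighbours w). u = y x"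
    using Z w stabilised u(1) by (rule orbits_of_neighbourhood_cover)
  then obtain y x where y: "y \<in> Z" and x: "x \<in> insert w (neighbours w)" and u_eq: "u = y x"
    by blast
  have xV: "x \<in> V" using x w neighbours_mem_V(2) by blast
  have "y (z x) = y x"
    using elementary_abelian_apply_commute[OF Z y z(1) xV] u(2) u_eq by simp
  then have "z x = x" using apply_eq_iff[OF ZG[OF y]] xV ZG[OF z(1)] by simp
  then show ?thesis using x z(2) by blast
qed

lemma card_stabilizer_of_neighbour_le:
  assumes Z: "subgroup Z \<G>" and free: "\<And>z. z \<in> Z \<Longrightarrow> z w = w \<Longrightarrow> z = \<one>"
    and x: "x \<in> neighbours w"
  shows "card {z \<in> Z. z x = x} \<le> 3"
proof -
  note V = neighbours_mem_V[OF x]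
  note ZG = subgroup_mem_G[OF Z]
  have "inj_on (\<lambda>z. z w) {z \<in> Z. z x = x}"
  proof (rule inj_onI)
    fix y z assume y: "y \<in> {z \<in> Z. z x = x}" and z: "z \<in> {z \<in> Z. z x = x}" and eq: "y w = z w"
    have "(inv z \<otimes> y) w = w" using y z eq V(1) ZG by simp
    then have "inv z \<otimes> y = \<one>"
      using free y z subgroup.m_closed[OF Z] subgroup.m_inv_closed[OF Z] by blast
    then show "y = z" using y z ZG inv_solve_left[of \<one> z y] by simp
  qed
  moreover have "(\<lambda>z. z w) ` {z \<in> Z. z x = x} \<subseteq> neighbours x"
    using neighbours_fixed[OF ZG V(2)] x neighbours_sym by blast
  ultimately have "card {z \<in> Z. z x = x} \<le> card (neighbours x)"
    using finite_neighbours by (rule card_inj_on_le)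
  then show ?thesis using card_neighbours[OF V(2)] by simp
qed

text \<open>If every element of \<open>Z\<close> has a fixed point, then \<open>Z\<close> is the union of the stabilisers of the three
  neighbours of \<open>w\<close>. They are too small to cover it unless \<open>card Z = 3\<close>.\<close>

context
  fixes Z w
  assumes Z: "elementary_abelian 3 Z" and w: "w \<in> V"
    and fixed_point: "\<And>z. z \<in> Z \<Longrightarrow> \<exists>u\<in>V. z u = u"
    and free: "\<And>z. z \<in> Z \<Longrightarrow> z w = w \<Longrightarrow> z = \<one>"
    and stabilised: "\<And>x. x \<in> neighbours w \<Longrightarrow> \<exists>b\<in>Z. b \<noteq> \<one> \<and> b x = x"
begin

lemma elementary_abelian_three_covered:
  "Z - {\<one>} \<subseteq> (\<Union>y\<in>neighbours w. {z \<in> Z. z y = y} - {\<one>})"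
proof
  fix b assume b: "b \<in> Z - {\<one>}"
  then obtain u where "u \<in> V" "b u = u" using fixed_point by blast
  then obtain y where "y \<in> neighbours w" "b y = y"
    using fixes_neighbour_if_fixed_point[OF Z w stabilised] b free by blast
  then show "b \<in> (\<Union>y\<in>neighbours w. {z \<in> Z. z y = y} - {\<one>})" using b by auto
qed

lemma card_elementary_abelian_three_le: "card Z \<le> 7"
proof -
  note sub = elementary_abelian_imp_subgroup[OF Z]
  have "card (Z - {\<one>}) \<le> card (\<Union>y\<in>neighbours w. {z \<in> Z. z y = y} - {\<one>})"
    using finite_neighbours finite_subgroup[OF sub]
    by (intro card_mono elementary_abelian_three_covered) auto
  also have "\<dots> \<le> (\<Sum>y\<in>neighbours w. card ({z \<in> Z. z y = y} - {\<one>}))"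
    by (rule card_UN_le[OF finite_neighbours])
  also have "\<dots> \<le> of_nat (card (neighbours w)) * 2"
  proof (rule sum_bounded_above)
    fix y assume y: "y \<in> neighbours w"
    have "\<one> \<in> {z \<in> Z. z y = y}" using subgroup.one_closed[OF sub] neighbours_mem_V(2)[OF y] by simp
    then show "card ({z \<in> Z. z y = y} - {\<one>}) \<le> 2"
      using card_stabilizer_of_neighbour_le[OF sub free y] by simp
  qed
  finally have "card (Z - {\<one>}) \<le> 6" using card_neighbours[OF w] by simp
  then show ?thesis using subgroup.one_closed[OF sub] by simp
qed

lemma elementary_abelian_three_fixes_neighbours:
  assumes z: "z \<in> Z" and x: "x \<in> neighbours w"
  shows "z x = x"
proof -
  define S where "S = {z \<in> Z. z x = x}"
  note sub = elementary_abelian_imp_subgroup[OF Z]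
  note finZ = finite_subgroup[OF sub]
  have S_dvd: "card S dvd card Z"
    using card_subgroup_dvd[OF point_stabilizer_subgroup[OF sub neighbours_mem_V(2)[OF x]] sub]
    by (auto simp: S_def)
  obtain b where b: "b \<in> Z" "b \<noteq> \<one>" "b x = x" using stabilised[OF x] by blast
  then have "card {\<one>, b} \<le> card S"
    using finZ subgroup.one_closed[OF sub] neighbours_mem_V(2)[OF x]
    by (intro card_mono) (auto simp: S_def)
  then have S_card: "card S \<noteq> 1" using b(2) by simp
  obtain k where k: "card Z = 3 ^ k"
    using elementary_abelian_card[OF Z finZ] by auto
  have "k < 2"
  proof (rule ccontr)
    assume "\<not> k < 2"
    then have "(3::nat) ^ 2 \<le> 3 ^ k" by (intro power_increasing) auto
    then show False using card_elementary_abelian_three_le k by simp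
  qed
  moreover have "k \<noteq> 0" using k S_dvd S_card by (cases k) auto
  ultimately have "k = 1" by linarith
  then have "card Z = 3" using k by simp
  moreover have "prime (3::nat)" by simp
  ultimately have "card S = card Z"
    using S_dvd S_card by (metis prime_nat_iff)
  then have "S = Z" using finZ by (intro card_subset_eq) (auto simp: S_def)
  then show ?thesis using z by (auto simp: S_def)
qed

end

theorem semiregular_if_normal_elementary_abelian_three:
  assumes Z: "Z \<lhd> \<G>" "Z \<noteq> {\<one>}" "elementary_abelian 3 Z"
  shows "\<exists>g\<in>G. semiregular_element V g"
proof (rule ccontr)
  assume none: "\<not> ?thesis"
  note sub = normal_imp_subgroup[OF Z(1)]
  note ZG = elementary_abelian_mem_G[OF Z(3)]
  have cube: "z [^] (3::nat) = \<one>" if "z \<in> Z" for z using Z(3) that by (simp add: elementary_abelian_def)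
  have fixed_point: "\<exists>v\<in>V. z v = v" if z: "z \<in> Z" for z
  proof (cases "z = \<one>")
    case False
    then have "ord z = 3" using elementary_abelian_ord[OF Z(3) _ z] by simp
    then show ?thesis using none semiregular_element_if_prime_ord[OF ZG[OF z]] ZG[OF z] by force
  qed (use V_nonempty in auto)
  obtain a where a: "a \<in> Z" "a \<noteq> \<one>" using Z(2) subgroup.one_closed[OF sub] by blast
  obtain v where v: "v \<in> V" "a v = v" using fixed_point[OF a(1)] by blast
  obtain w where w: "w \<in> neighbours v" using neighbours_nonempty[OF v(1)] by blast
  have vw: "v \<in> neighbours w" and wV: "w \<in> V" using w neighbours_sym neighbours_mem_V by auto
  have "a x = x" if x: "x \<in> neighbours w" for x
  proof (cases "\<exists>b\<in>Z. b \<noteq> \<one> \<and> b w = w")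
    case True
    then obtain b where b: "b \<in> Z" "b \<noteq> \<one>" "b w = w" by blast
    show ?thesis
      using elementary_abelian_apply_commute[OF Z(3) a(1) b(1)]
        neighbours_eq_rotation[OF ZG[OF b(1)] cube[OF b(1)] b(2) wV b(3) vw] x v b(1) ZG by auto
  next
    case False
    have stabilised: "\<exists>b\<in>Z. b \<noteq> \<one> \<and> b y = y" if y: "y \<in> neighbours w" for y
    proof -
      obtain g where "g \<in> G" "g v = y" using locally_transitive[OF vw y] by blast
      then show ?thesis using normal_fixing_transport[OF Z(1) _ a v] by blast
    qed
    show ?thesis
      using elementary_abelian_three_fixes_neighbours[OF Z(3) wV fixed_point _ stabilised a(1) x] False
      by blast
  qed
  then show False
    using none semiregular_if_fixes_neighbours_of_neighbour[OF ZG[OF a(1)] cube[OF a(1)] a(2) v(2) w]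
    by blast
qed

lemma G_nontrivial: "G \<noteq> {\<one>}"
proof -
  obtain v where v: "v \<in> V" using V_nonempty by blast
  obtain x where x: "x \<in> neighbours v" using neighbours_nonempty[OF v] by blast
  obtain c where "c \<in> G" "c x \<noteq> x" using exists_three_cycle_on_neighbours[OF v] x by metis
  then show ?thesis using neighbours_mem_V(2)[OF x] one_apply by blast
qed

theorem exists_semiregular_element: "\<exists>g\<in>G. semiregular_element V g"
proof (cases "\<exists>p. prime p \<and> p dvd card G \<and> p > 3")
  case True
  then show ?thesis using semiregular_if_large_prime_dvd_card by blast
next
  case False
  have factors: "prime_factors (order \<G>) \<subseteq> {2, 3}"
  proof
    fix p assume "p \<in> prime_factors (order \<G>)"
    then have p: "prime p" "p dvd card G" by (auto simp: order_def)
    then have "p \<le> 3" using False by (meson not_le)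
    then show "p \<in> {2, 3}" using prime_ge_2_nat[OF p(1)] by auto
  qed
  have fin: "finite (carrier \<G>)" using finite_G by simp
  obtain p Z where Z: "p \<in> prime_factors (order \<G>)" "Z \<lhd> \<G>" "Z \<noteq> {\<one>}" "elementary_abelian p Z"
    using solvable_exists_elementary_abelian_normal[OF solvable_if_prime_factors[OF fin factors] fin]
      G_nontrivial by auto
  consider "p = 2" | "p = 3" using Z(1) factors by blast
  then show ?thesis
    by cases (use Z semiregular_if_normal_elementary_abelian_two
        semiregular_if_normal_elementary_abelian_three in blast)+
qed

end

theorem theorem1p2:
  fixes V :: "'a set" and E :: "'a \<Rightarrow> 'a \<Rightarrow> bool" and G :: "('a \<Rightarrow> 'a) set"
  assumes "simple_graph V E" and "connected_graph V E" and "cubic V E"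
    and "subgroup G (BijGroup V)" and "G \<subseteq> graph_aut V E"
    and "edge_transitive E G"
  shows "\<exists>g\<in>G. semiregular_element V g"
proof -
  have "finite V" using assms(1) by (simp add: simple_graph_def)
  interpret subgroup G "BijGroup V" by fact
  interpret edge_transitive_cubic_graph V G "BijGroup V\<lparr>carrier := G\<rparr>" E
    by unfold_locales (use assms \<open>finite V\<close> in auto)
  show ?thesis by (rule exists_semiregular_element)
qed

end
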